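(* Suppose $d\in\{1,2,3\}$, $\alpha>2$, and that the implicit midpoint scheme always has a unique and bounded solution (the assumption stated in the context). Let $\Phi_\tau^*:L^2\to L^2$ be the neural network approximation of $\Phi_\tau$ described in the context. Then there exist constants $\tilde C_1$, $\tilde C_2$ and $\tau_0$ such that the following holds. Given $\epsilon>0$ there is an $N_\epsilon\in\mathbb{N}$ such that for all $N_{data}>N_\epsilon$ we can find a finite sequence of training data $\{u_j\}_{j=1}^{N_{data}}\subset B_{H^\alpha}(0,1)\cap B_{L^\infty}(0,1)$ such that for all $\tau<\tau_0$ we have the estimate $$\mathcal{E}_G^\infty\le\tilde C_1\,\mathcal{E}_T^\infty+\tilde C_2\,\epsilon .$$ Furthermore, $N_\epsilon$ scales no worse than $$N_\epsilon\lesssim\left\lceil\left(\frac4\epsilon\right)^{2^d\left(2\left(\frac\epsilon2\right)^{\frac{1}{2-\alpha}}+1\right)^d}\right\rceil .$$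
   Context: Function spaces. $\Omega=\mathbb{T}^d=[-\pi,\pi]^d$ with periodic boundary conditions. For $u\in L^2=L^2(\Omega)$ let $\hat u_{\mathbf{k}}=(2\pi)^{-d}\int_\Omega u(x)e^{-i\mathbf{k}\cdot x}dx$, $\mathbf{k}\in\mathbb{Z}^d$, and $\|u\|_{H^s}^2=\sum_{\mathbf{k}\in\mathbb{Z}^d}\langle\mathbf{k}\rangle^{2s}|\hat u_{\mathbf{k}}|^2$, where $\langle\mathbf{k}\rangle=|\mathbf{k}|$ for $\mathbf{k}\ne\mathbf{0}$ and $\langle\mathbf{0}\rangle=1$. $H^s=\{u\in L^2(\Omega):\|u\|_{H^s}<\infty\}$. For a Banach space $X$, $B_X(0,R)=\{u\in X:\|u\|_X\le R\}$. Scheme. Let $\varepsilon_{AC}>0$. The implicit midpoint scheme with time step $\tau$ for the Allen–Cahn equation $\partial_tu=\varepsilon_{AC}^2\Delta u-u^3+u$ is $u^{n+1}=\Psi_\tau(u^n,u^{n+1})$, where $$\Psi_\tau(u,v):=u+\tau\,\mathcal{L}\!\left(\tfrac12(u+v)\right),\qquad \mathcal{L}(w)=\varepsilon_{AC}^2\Delta w-w^3+w ,$$ and $\Phi_\tau(u)$ denotes its exact solution, $\Psi_\tau(u,\Phi_\tau(u))=\Phi_\tau(u)$. Assumption: the implicit midpoint scheme always has a unique and bounded solution, i.e. given $u\in H^\alpha$, the solution $\Phi_\tau(u)$ uniquely exists and is bounded in $\|\cdot\|_{H^\alpha}$. Network. $\Phi_\tau^*:L^2\to L^2$ is the neural network approximation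 of $\Phi_\tau$, regarded as a map on function spaces; it is a Lipschitz continuous map. Errors. For training data $u_j$, $1\le j\le N_{data}$, the maximum training error is $$\mathcal{E}_T^\infty=\max_{1\le j\le N_{data}}\|\Psi_\tau(u_j,\Phi_\tau^*(u_j))-\Phi_\tau^*(u_j)\|_{L^2},$$ and the maximum generalisation error is $$\mathcal{E}_G^\infty=\sup_{u\in B_{H^\alpha}(0,1)\cap B_{L^\infty}(0,1)}\|\Phi_\tau(u)-\Phi_\tau^*(u)\|_{L^2}.$$ The symbol $\lesssim$ denotes an inequality up to a constant factor independent of $\epsilon$.
   Formalization: The Lipschitz constant of the networks is assumed to be the same for all small time steps τ (otherwise the claim fails), and the scheme is assumed uniquely solvable only for 0 < τ < τ_max, since solvability for all τ is false. *)

theory Defs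
  imports "HOL-Analysis.Analysis" "HOL-Probability.Essential_Supremum"
begin

text \<open>Function spaces on the torus. The dimension \<open>d\<close> is \<open>CARD('d)\<close>. Elements of \<open>L\<^sup>2\<close> are
  represented by functions; equality in \<open>L\<^sup>2\<close> is equality almost everywhere on the torus.\<close>

definition torus :: "(real ^ 'd) measure" where
  "torus = lebesgue_on (cbox (\<chi> i. - pi) (\<chi> i. pi))"

definition L2 :: "(real ^ 'd \<Rightarrow> real) set" where
  "L2 = {u \<in> borel_measurable torus. integrable torus (\<lambda>x. (u x)\<^sup>2)}"

definition L2_norm :: "(real ^ 'd \<Rightarrow> real) \<Rightarrow> real" where
  "L2_norm u = sqrt (LINT x|torus. (u x)\<^sup>2)"

definition L2_enorm :: "(real ^ 'd \<Rightarrow> real) \<Rightarrow> ennreal" where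
  "L2_enorm u = (if u \<in> L2 then ennreal (L2_norm u) else \<infinity>)"

definition freq :: "int ^ 'd \<Rightarrow> real ^ 'd" where
  "freq k = (\<chi> i. of_int (k $ i))"

definition fourier_coeff :: "(real ^ 'd \<Rightarrow> real) \<Rightarrow> int ^ 'd \<Rightarrow> complex" where
  "fourier_coeff u k = 1 / (2 * of_real pi) ^ CARD('d) *
     (LINT x|torus. of_real (u x) * exp (- (\<i> * of_real (freq k \<bullet> x))))"

definition bracket :: "int ^ 'd \<Rightarrow> real" where
  "bracket k = (if k = 0 then 1 else norm (freq k))"

definition Hs :: "real \<Rightarrow> (real ^ 'd \<Rightarrow> real) set" where
  "Hs s = {u \<in> L2. (\<lambda>k. bracket k powr (2 * s) * (cmod (fourier_coeff u k))\<^sup>2) summable_on UNIV}"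

definition Hs_norm :: "real \<Rightarrow> (real ^ 'd \<Rightarrow> real) \<Rightarrow> real" where
  "Hs_norm s u = sqrt (\<Sum>\<^sub>\<infinity>k. bracket k powr (2 * s) * (cmod (fourier_coeff u k))\<^sup>2)"

definition ball_Hs :: "real \<Rightarrow> real \<Rightarrow> (real ^ 'd \<Rightarrow> real) set" where
  "ball_Hs s R = {u \<in> Hs s. Hs_norm s u \<le> R}"

definition ball_Linf :: "real \<Rightarrow> (real ^ 'd \<Rightarrow> real) set" where
  "ball_Linf R = {u \<in> borel_measurable torus. esssup torus (\<lambda>x. ereal \<bar>u x\<bar>) \<le> ereal R}"

text \<open>\<open>has_laplacian u g\<close>: \<open>g\<close> is the distributional Laplacian of \<open>u\<close> and lies in \<open>L\<^sup>2\<close>. Such a \<open>g\<close>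
  is unique almost everywhere, and it exists precisely for \<open>u \<in> Hs 2\<close>.\<close>

definition has_laplacian :: "(real ^ 'd \<Rightarrow> real) \<Rightarrow> (real ^ 'd \<Rightarrow> real) \<Rightarrow> bool" where
  "has_laplacian u g \<longleftrightarrow> u \<in> L2 \<and> g \<in> L2 \<and>
     (\<forall>k. fourier_coeff g k = - of_real ((norm (freq k))\<^sup>2) * fourier_coeff u k)"

definition laplacian_dom :: "(real ^ 'd \<Rightarrow> real) set" where
  "laplacian_dom = {u. \<exists>g. has_laplacian u g}"

definition laplacian :: "(real ^ 'd \<Rightarrow> real) \<Rightarrow> real ^ 'd \<Rightarrow> real" where
  "laplacian u = (SOME g. has_laplacian u g)"

definition AC_rhs :: "real \<Rightarrow> (real ^ 'd \<Rightarrow> real) \<Rightarrow> real ^ 'd \<Rightarrow> real" where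
  "AC_rhs \<epsilon>AC w = (\<lambda>x. \<epsilon>AC\<^sup>2 * laplacian w x - (w x) ^ 3 + w x)"

definition midpoint :: "(real ^ 'd \<Rightarrow> real) \<Rightarrow> (real ^ 'd \<Rightarrow> real) \<Rightarrow> real ^ 'd \<Rightarrow> real" where
  "midpoint u v = (\<lambda>x. (u x + v x) / 2)"

definition Psi ::
  "real \<Rightarrow> real \<Rightarrow> (real ^ 'd \<Rightarrow> real) \<Rightarrow> (real ^ 'd \<Rightarrow> real) \<Rightarrow> real ^ 'd \<Rightarrow> real" where
  "Psi \<epsilon>AC \<tau> u v = (\<lambda>x. u x + \<tau> * AC_rhs \<epsilon>AC (midpoint u v) x)"

definition midpoint_solution ::
  "real \<Rightarrow> real \<Rightarrow> real \<Rightarrow> (real ^ 'd \<Rightarrow> real) \<Rightarrow> (real ^ 'd \<Rightarrow> real) \<Rightarrow> bool" where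
  "midpoint_solution \<epsilon>AC \<alpha> \<tau> u v \<longleftrightarrow>
     v \<in> Hs \<alpha> \<and> midpoint u v \<in> laplacian_dom \<and> (AE x in torus. Psi \<epsilon>AC \<tau> u v x = v x)"

text \<open>Unique existence up to equality almost everywhere; boundedness of the solution in the
  \<open>Hs \<alpha>\<close> norm is the conjunct \<open>v \<in> Hs \<alpha>\<close> of the notion of solution.\<close>

definition midpoint_wellposed :: "'d::finite itself \<Rightarrow> real \<Rightarrow> real \<Rightarrow> real \<Rightarrow> bool" where
  "midpoint_wellposed _ \<epsilon>AC \<alpha> \<tau> \<longleftrightarrow>
     (\<forall>u :: real ^ 'd \<Rightarrow> real. u \<in> Hs \<alpha> \<longrightarrow>
        (\<exists>v. midpoint_solution \<epsilon>AC \<alpha> \<tau> u v) \<and>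
        (\<forall>v w. midpoint_solution \<epsilon>AC \<alpha> \<tau> u v \<longrightarrow> midpoint_solution \<epsilon>AC \<alpha> \<tau> u w \<longrightarrow>
           (AE x in torus. v x = w x)))"

definition Phi :: "real \<Rightarrow> real \<Rightarrow> real \<Rightarrow> (real ^ 'd \<Rightarrow> real) \<Rightarrow> real ^ 'd \<Rightarrow> real" where
  "Phi \<epsilon>AC \<alpha> \<tau> u = (SOME v. midpoint_solution \<epsilon>AC \<alpha> \<tau> u v)"

definition L2_Lipschitz ::
  "real \<Rightarrow> ((real ^ 'd \<Rightarrow> real) \<Rightarrow> real ^ 'd \<Rightarrow> real) \<Rightarrow> bool" where
  "L2_Lipschitz L F \<longleftrightarrow>
     (\<forall>u\<in>L2. F u \<in> L2) \<and>
     (\<forall>u\<in>L2. \<forall>v\<in>L2. L2_norm (\<lambda>x. F u x - F v x) \<le> L * L2_norm (\<lambda>x. u x - v x))"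

text \<open>The values of a network are only known to lie in \<open>L\<^sup>2\<close>. Where the residual
  \<open>Psi \<epsilon>AC \<tau> u v - v\<close> is not an element of \<open>L\<^sup>2\<close>, in particular where the Laplacian in it is not,
  its norm is infinite.\<close>

definition residual_enorm ::
  "real \<Rightarrow> real \<Rightarrow> (real ^ 'd \<Rightarrow> real) \<Rightarrow> (real ^ 'd \<Rightarrow> real) \<Rightarrow> ennreal" where
  "residual_enorm \<epsilon>AC \<tau> u v =
     (if midpoint u v \<in> laplacian_dom then L2_enorm (\<lambda>x. Psi \<epsilon>AC \<tau> u v x - v x) else \<infinity>)"

definition training_error ::
  "real \<Rightarrow> real \<Rightarrow> ((real ^ 'd \<Rightarrow> real) \<Rightarrow> real ^ 'd \<Rightarrow> real) \<Rightarrow>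
   nat \<Rightarrow> (nat \<Rightarrow> real ^ 'd \<Rightarrow> real) \<Rightarrow> ennreal" where
  "training_error \<epsilon>AC \<tau> F N u = Max ((\<lambda>j. residual_enorm \<epsilon>AC \<tau> (u j) (F (u j))) ` {1..N})"

definition generalisation_error ::
  "real \<Rightarrow> real \<Rightarrow> real \<Rightarrow> ((real ^ 'd \<Rightarrow> real) \<Rightarrow> real ^ 'd \<Rightarrow> real) \<Rightarrow> ennreal" where
  "generalisation_error \<epsilon>AC \<alpha> \<tau> F =
     (SUP u \<in> ball_Hs \<alpha> 1 \<inter> ball_Linf 1. L2_enorm (\<lambda>x. Phi \<epsilon>AC \<alpha> \<tau> u x - F u x))"

end

theory Submission
  imports Defs
begin

text \<open>
  Everything happens in the norm of \<open>L\<^sup>2\<close>. Two facts carry the proof: the midpoint scheme is stable in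
  this norm, and the data set \<open>ball_Hs \<alpha> 1 \<inter> ball_Linf 1\<close> is totally bounded in it, with covering numbers
  that can be estimated.

  Stability (\<open>midpoint_scheme_stability\<close>). Let \<open>r\<^sub>i = Psi \<epsilon>AC \<tau> u\<^sub>i v\<^sub>i - v\<^sub>i\<close> be the residuals of two arbitrary steps
  from \<open>u\<^sub>i\<close> to \<open>v\<^sub>i\<close>. Subtract the two equations and test with the difference \<open>z\<close> of the midpoints. The
  Laplacian is dissipative and the cube is monotone, so both contribute with a favourable sign; since
  \<open>2 z = (u\<^sub>1 - u\<^sub>2) + (v\<^sub>1 - v\<^sub>2)\<close>, the differences of old and new values combine to a difference of squares;
  the reaction term is of size \<open>\<tau> z\<^sup>2\<close> and is absorbed for \<open>\<tau> \<le> 1 / 4\<close>. Hence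
  \<open>\<parallel>v\<^sub>1 - v\<^sub>2\<parallel>\<^sup>2 \<le> 3 \<parallel>u\<^sub>1 - u\<^sub>2\<parallel>\<^sup>2 + 4 \<parallel>r\<^sub>1 - r\<^sub>2\<parallel>\<^sup>2\<close>. Take for the first step the exact one from a function \<open>u\<close>,
  whose residual vanishes, and for the second the network step from a training datum \<open>p\<close>, whose residual
  is what the training error measures. Together with the Lipschitz bound of the network between \<open>u\<close> and
  \<open>p\<close>, this bounds the error at \<open>u\<close> by the training error and the distance of \<open>u\<close> from \<open>p\<close>
  (\<open>generalisation_from_nearby_sample\<close>).

  Covering (\<open>ball_Hs_cover\<close>). Fourier coefficients beyond frequency \<open>m\<close> contribute little to the \<open>L\<^sup>2\<close> norm,
  because of the weights in the Sobolev norm. The finitely many others lie in the unit disc. Sort functions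
  by the grid cell of mesh \<open>1 / n\<close> in which each of these coefficients lies, and choose one datum from every
  inhabited cell; the data then belong to the required balls by construction. Cutting off at
  \<open>m \<approx> \<epsilon> powr (- 1 / \<alpha>)\<close> leaves, for small \<open>\<epsilon>\<close>, far fewer coefficients than the
  \<open>\<epsilon> powr (- 1 / (\<alpha> - 2))\<close> per direction of the asserted bound, and this surplus pays for all constants and for
  the finer mesh (\<open>cover_parameters\<close>). For the remaining, large \<open>\<epsilon>\<close> the zero function is a sufficient
  training set once the constant in front of \<open>\<epsilon>\<close> is large (\<open>training_set\<close>).

  Both the dissipativity of a Laplacian that is defined through Fourier coefficients and the distance
  estimate of the covering rest on Parseval's identity on the torus (\<open>parseval\<close>), which is proved with the
  Stone--Weierstrass theorem on a product of unit circles.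
\<close>

section \<open>Plane waves on the torus\<close>

definition wave :: "int ^ 'd \<Rightarrow> real ^ 'd \<Rightarrow> complex" where
  "wave k x = exp (\<i> * of_real (freq k \<bullet> x))"

abbreviation torus_volume :: "'d itself \<Rightarrow> real" where
  "torus_volume _ \<equiv> (2 * pi) ^ CARD('d)"

abbreviation cube :: "(real ^ 'd) set" where
  "cube \<equiv> cbox (\<chi> i. - pi) (\<chi> i. pi)"

lemma norm_wave [simp]: "norm (wave k x) = 1"
  by (simp add: wave_def norm_exp_i_times)

lemma wave_zero [simp]: "wave 0 x = 1"
  by (simp add: wave_def freq_def zero_vec_def[symmetric])

lemma freq_add: "freq (k + l) = freq k + freq l"
  by (simp add: freq_def vec_eq_iff)

lemma freq_uminus: "freq (- k) = - freq k"
  by (simp add: freq_def vec_eq_iff)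

lemma wave_add: "wave (k + l) x = wave k x * wave l x"
  by (simp add: wave_def freq_add inner_add_left distrib_left exp_add)

lemma wave_uminus: "wave (- k) x = cnj (wave k x)"
  by (simp add: wave_def freq_uminus exp_cnj)

lemma wave_mult_cnj: "wave k x * cnj (wave l x) = wave (k - l) x"
  by (simp add: wave_uminus[symmetric] wave_add[symmetric])

lemma continuous_wave [continuous_intros]: "continuous_on S (wave k)"
  unfolding wave_def by (intro continuous_intros)

lemma borel_measurable_wave [measurable]: "wave k \<in> borel_measurable borel"
  by (intro borel_measurable_continuous_onI continuous_wave)

lemma borel_imp_torus_measurable:
  "f \<in> borel_measurable borel \<Longrightarrow> f \<in> borel_measurable torus"
  unfolding torus_def
  by (intro measurable_restrict_space1 measurable_completion) simp

lemma wave_torus_measurable [measurable]: "wave k \<in> borel_measurable torus"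
  by (intro borel_imp_torus_measurable borel_measurable_wave)

lemma space_torus: "space torus = cube"
  by (simp add: torus_def)

lemma finite_measure_torus: "finite_measure torus"
  unfolding torus_def by (intro finite_measure_lebesgue_on lmeasurable_cbox)

lemma integrable_bounded_torus:
  fixes f :: "real ^ 'd \<Rightarrow> 'b :: {banach, second_countable_topology}"
  assumes "f \<in> borel_measurable torus" "\<And>x. norm (f x) \<le> B"
  shows "integrable torus f"
  using finite_measure.integrable_const_bound[OF finite_measure_torus _ assms(1)] assms(2) by auto

lemma integral_exp_period:
  fixes n :: int
  shows "(LINT t|lborel. indicator {-pi..pi} t *\<^sub>R exp (\<i> * of_real (of_int n * t)))
     = (if n = 0 then 2 * of_real pi else 0)"
proof (cases "n = 0")
  case True
  then show ?thesis by (simp add: scaleR_conv_of_real)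
next
  case False
  let ?F = "\<lambda>t::real. exp (\<i> * of_real (of_int n * t)) / (\<i> * of_int n)"
  have "(LINT t|lborel. indicator {-pi..pi} t *\<^sub>R exp (\<i> * of_real (of_int n * t)))
      = ?F pi - ?F (- pi)"
  proof (rule integral_FTC_Icc)
    show "(?F has_vector_derivative exp (\<i> * of_real (of_int n * t))) (at t within {- pi..pi})" for t
      using False by (auto intro!: derivative_eq_intros simp: has_vector_derivative_complex_iff
          Re_exp Im_exp Re_divide Im_divide power2_eq_square field_simps)
  qed (auto intro!: continuous_intros)
  moreover have "exp (\<i> * of_real (of_int n * pi)) = exp (\<i> * of_real (of_int n * (- pi)))"
    by (rule complex_eqI) (simp_all add: Re_exp Im_exp sin_npi_int mult.commute)
  ultimately show ?thesis using False by simp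
qed

text \<open>The passage from the completed measure to \<open>lborel\<close> makes the product structure of Lebesgue measure
  accessible.\<close>

lemma torus_integral_eq_lborel:
  fixes f :: "real ^ 'd \<Rightarrow> complex"
  assumes [measurable]: "f \<in> borel_measurable borel"
  shows "(LINT x|torus. f x)
    = (LINT x|lborel. indicator cube x *\<^sub>R f x)"
proof -
  have "(LINT x|torus. f x)
      = (LINT x|lebesgue. indicator cube x *\<^sub>R f x)"
    unfolding torus_def by (subst integral_restrict_space) simp_all
  also have "\<dots> = (LINT x|lborel. indicator cube x *\<^sub>R f x)"
    by (rule integral_completion) measurable
  finally show ?thesis .
qed

text \<open>A plane wave is a product of functions of one coordinate each, so Fubini reduces the claim to one
  dimension. With \<open>wave_mult_cnj\<close> this is the orthogonality of the plane waves.\<close>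

lemma integral_wave:
  fixes k :: "int ^ 'd"
  shows "(LINT x|torus. wave k x) = (if k = 0 then of_real (torus_volume TYPE('d)) else 0)"
proof -
  interpret product_sigma_finite "\<lambda>_::real ^ 'd. lborel :: real measure" ..
  \<comment> \<open>The coordinate of \<open>k\<close> in the direction of a basis vector \<open>b\<close>, as an integer: the product formula
    for \<open>lborel\<close> is indexed by \<open>Basis\<close> and not by \<open>'d\<close>.\<close>
  define n where "n b = (\<Sum>i\<in>UNIV. if b = axis i 1 then k $ i else 0)" for b :: "real ^ 'd"
  define g where "g b t = indicator {-pi..pi} t *\<^sub>R exp (\<i> * of_real (of_int (n b) * t))"
    for b :: "real ^ 'd" and t :: real
  have n_axis: "n (axis i 1) = k $ i" for i
    unfolding n_def by (simp add: axis_eq_axis)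
  have n_Basis: "of_int (n b) = freq k \<bullet> b" if "b \<in> Basis" for b
    using that by (auto simp: Basis_vec_def n_axis inner_axis freq_def)
  have split: "indicator cube x *\<^sub>R wave k x = (\<Prod>b\<in>Basis. g b (x \<bullet> b))"
    for x :: "real ^ 'd"
  proof (cases "x \<in> cube")
    case True
    then have "x \<bullet> b \<in> {-pi..pi}" if "b \<in> Basis" for b
      using that by (auto simp: Basis_vec_def inner_axis mem_box_cart)
    then have "(\<Prod>b\<in>Basis. g b (x \<bullet> b))
        = (\<Prod>b\<in>Basis. exp (\<i> * of_real ((freq k \<bullet> b) * (x \<bullet> b))))"
      by (intro prod.cong refl) (simp add: g_def n_Basis)
    also have "\<dots> = wave k x"
      by (simp add: wave_def exp_sum[symmetric] sum_distrib_left[symmetric]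
          euclidean_inner[of "freq k" x] flip: of_real_sum of_real_mult)
    finally show ?thesis using True by simp
  next
    case False
    then obtain i where "x $ i \<notin> {-pi..pi}" by (auto simp: mem_box_cart)
    then have "g (axis i 1) (x \<bullet> axis i 1) = 0"
      by (simp add: g_def inner_axis)
    moreover have "axis i 1 \<in> (Basis :: (real ^ 'd) set)" by (simp add: axis_in_Basis_iff)
    ultimately show ?thesis
      using False by (metis finite_Basis indicator_simps(2) prod_zero scaleR_zero_left)
  qed
  have g_meas [measurable]: "g b \<in> borel_measurable borel" for b
    unfolding g_def by measurable
  have g_int: "integrable lborel (g b)" for b
    unfolding g_def by (intro borel_integrable_compact continuous_intros) simp
  have "(LINT x|torus. wave k x) = (LINT x|lborel. (\<Prod>b\<in>Basis. g b (x \<bullet> b)))"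
    by (subst torus_integral_eq_lborel) (simp_all add: split)
  also have "\<dots> = (LINT f|(\<Pi>\<^sub>M b\<in>(Basis::(real^'d) set). lborel).
      (\<Prod>b\<in>Basis. g b ((\<Sum>c\<in>Basis. f c *\<^sub>R c) \<bullet> b)))"
    by (subst lborel_eq, subst integral_distr) simp_all
  also have "\<dots> = (LINT f|(\<Pi>\<^sub>M b\<in>(Basis::(real^'d) set). lborel). (\<Prod>b\<in>Basis. g b (f b)))"
    by simp
  also have "\<dots> = (\<Prod>b\<in>(Basis::(real^'d) set). LINT t|lborel. g b t)"
    by (rule product_integral_prod) (simp_all add: g_int)
  also have "\<dots> = (\<Prod>b\<in>(Basis::(real^'d) set). if n b = 0 then 2 * of_real pi else 0)"
    unfolding g_def integral_exp_period ..
  also have "\<dots> = (if k = 0 then of_real (torus_volume TYPE('d)) else 0)"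
  proof (cases "k = 0")
    case True
    then have "n b = 0" for b by (simp add: n_def cong: if_cong)
    with True show ?thesis by (simp add: power_mult_distrib)
  next
    case False
    then obtain i where "k $ i \<noteq> 0" by (auto simp: vec_eq_iff)
    then have "\<exists>b\<in>(Basis::(real^'d) set). n b \<noteq> 0"
      by (metis axis_in_Basis_iff n_axis Basis_real_def singletonI)
    with False show ?thesis by (auto intro!: prod_zero)
  qed
  finally show ?thesis .
qed

section \<open>Density of trigonometric polynomials\<close>

inductive trig_poly :: "(real ^ 'd \<Rightarrow> complex) \<Rightarrow> bool" where
  monomial: "trig_poly (\<lambda>x. c * wave k x)"
| add: "trig_poly f \<Longrightarrow> trig_poly g \<Longrightarrow> trig_poly (\<lambda>x. f x + g x)"

lemma trig_poly_const: "trig_poly (\<lambda>x. c)"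
  using monomial[of c 0] by simp

lemma trig_poly_mult:
  assumes "trig_poly f" "trig_poly g"
  shows "trig_poly (\<lambda>x. f x * g x)"
  using assms(1)
proof induction
  case (monomial c k)
  show ?case using assms(2)
  proof induction
    case (monomial c' k')
    then show ?case
      using trig_poly.monomial[of "c * c'" "k + k'"] by (simp add: wave_add mult_ac)
  qed (auto simp: distrib_left intro: trig_poly.add)
qed (auto simp: distrib_right intro: trig_poly.add)

lemma trig_poly_expansion:
  assumes "trig_poly f"
  obtains A c where "finite A" "\<And>x. f x = (\<Sum>k\<in>A. c k * wave k x)"
proof -
  have "\<exists>A c. finite A \<and> (\<forall>x. f x = (\<Sum>k\<in>A. c k * wave k x))"
    using assms
  proof induction
    case (monomial c k)
    show ?case by (intro exI[of _ "{k}"] exI[of _ "\<lambda>_. c"]) simp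
  next
    case (add f g)
    from add.IH(1) obtain A c where A: "finite A" "\<And>x. f x = (\<Sum>k\<in>A. c k * wave k x)"
      by blast
    from add.IH(2) obtain B c' where B: "finite B" "\<And>x. g x = (\<Sum>k\<in>B. c' k * wave k x)"
      by blast
    define a where "a k = (if k \<in> A then c k else 0) + (if k \<in> B then c' k else 0)" for k
    have "f x + g x = (\<Sum>k\<in>A \<union> B. a k * wave k x)" for x
    proof -
      have "f x = (\<Sum>k\<in>A \<union> B. (if k \<in> A then c k else 0) * wave k x)"
        unfolding A(2) using A(1) B(1) by (intro sum.mono_neutral_cong_left) auto
      moreover have "g x = (\<Sum>k\<in>A \<union> B. (if k \<in> B then c' k else 0) * wave k x)"
        unfolding B(2) using A(1) B(1) by (intro sum.mono_neutral_cong_left) auto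
      ultimately show ?thesis by (simp add: a_def distrib_right sum.distrib)
    qed
    with A(1) B(1) show ?case by (intro exI[of _ "A \<union> B"] exI[of _ a]) simp
  qed
  with that show thesis by blast
qed

lemma borel_measurable_trig_poly [measurable_dest]:
  "trig_poly f \<Longrightarrow> f \<in> borel_measurable torus"
  by (induction rule: trig_poly.induct) measurable

lemma wave_axis: "wave (axis i n) x = cis (of_int n * x $ i)"
proof -
  have "freq (axis i n) = axis i (of_int n)"
    by (simp add: freq_def axis_def vec_eq_iff)
  then show ?thesis
    by (simp add: wave_def inner_axis' cis_conv_exp)
qed

lemma trig_poly_cos:
  fixes i :: "'d::finite"
  shows "trig_poly (\<lambda>x. of_real (cos (x $ i)))"
proof -
  have "trig_poly (\<lambda>x. 1 / 2 * wave (axis i 1) x + 1 / 2 * wave (axis i (- 1)) x)"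
    by (intro trig_poly.intros)
  also have "(\<lambda>x. 1 / 2 * wave (axis i 1) x + 1 / 2 * wave (axis i (- 1)) x)
      = (\<lambda>x :: real ^ 'd. of_real (cos (x $ i)))"
    by (rule ext) (simp add: wave_axis complex_eq_iff)
  finally show ?thesis .
qed

lemma trig_poly_sin:
  fixes i :: "'d::finite"
  shows "trig_poly (\<lambda>x. of_real (sin (x $ i)))"
proof -
  have "trig_poly (\<lambda>x. - \<i> / 2 * wave (axis i 1) x + \<i> / 2 * wave (axis i (- 1)) x)"
    by (intro trig_poly.intros)
  also have "(\<lambda>x. - \<i> / 2 * wave (axis i 1) x + \<i> / 2 * wave (axis i (- 1)) x)
      = (\<lambda>x :: real ^ 'd. of_real (sin (x $ i)))"
    by (rule ext) (simp add: wave_axis complex_eq_iff)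
  finally show ?thesis .
qed

text \<open>Functions on the cube that vanish on its boundary are functions on the torus. The torus is realised as
  the image of the cube under this map, a product of unit circles, where the coordinates of a point and
  hence trigonometric polynomials separate points; on the closed cube itself they do not.\<close>

definition circle_map :: "real ^ 'd \<Rightarrow> complex ^ 'd" where
  "circle_map x = (\<chi> i. cis (x $ i))"

lemma continuous_circle_map: "continuous_on S circle_map"
  unfolding circle_map_def by (intro continuous_on_vec_lambda continuous_intros)

abbreviation open_cube :: "(real ^ 'd) set" where
  "open_cube \<equiv> box (\<chi> i. - pi) (\<chi> i. pi)"

lemma cis_eq_on_period:
  assumes "cis s = cis t" "s \<in> {-pi..pi}" "t \<in> {-pi..pi}" "s \<noteq> t"
  shows "\<bar>s\<bar> = pi" "\<bar>t\<bar> = pi"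
proof -
  have "sin s = sin t \<and> cos s = cos t"
    using assms(1) by (simp add: complex_eq_iff)
  then obtain n :: int where n: "s = t + 2 * pi * n"
    unfolding sin_cos_eq_iff by blast
  have *: "\<bar>2 * pi * of_int n\<bar> \<le> 2 * pi" using n assms(2,3) by auto
  then have "\<bar>of_int n :: real\<bar> \<le> 1" by (simp add: abs_mult)
  then have "n = 0 \<or> n = 1 \<or> n = -1" by linarith
  with n assms(2-4) show "\<bar>s\<bar> = pi" "\<bar>t\<bar> = pi" by auto
qed

lemma circle_map_eq_imp:
  assumes "circle_map x = circle_map y" "x \<in> cube" "y \<in> cube" "x \<noteq> y"
  shows "x \<notin> open_cube" "y \<notin> open_cube"
proof -
  obtain i where i: "x $ i \<noteq> y $ i" using assms(4) by (auto simp: vec_eq_iff)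
  have "cis (x $ i) = cis (y $ i)" using assms(1) by (simp add: circle_map_def vec_eq_iff)
  from cis_eq_on_period[OF this _ _ i] have "\<bar>x $ i\<bar> = pi" "\<bar>y $ i\<bar> = pi"
    using assms(2,3) by (auto simp: mem_box_cart)
  then have "x $ i \<notin> {-pi<..<pi}" "y $ i \<notin> {-pi<..<pi}" by auto
  then show "x \<notin> open_cube" "y \<notin> open_cube"
    unfolding mem_box_cart by (auto dest!: spec[of _ i])
qed

text \<open>The function \<open>h\<close> factors through \<open>circle_map\<close>, and the factor is continuous since \<open>circle_map\<close> is a closed
  map on the compact cube. Stone--Weierstrass applies to the factor.\<close>

lemma trig_poly_uniformly_dense:
  fixes h :: "real ^ 'd \<Rightarrow> real"
  assumes h: "continuous_on cube h" and bdry: "\<And>x. x \<in> cube \<Longrightarrow> x \<notin> open_cube \<Longrightarrow> h x = 0"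
    and "e > 0"
  obtains T where "trig_poly T" "\<And>x. x \<in> cube \<Longrightarrow> cmod (of_real (h x) - T x) < e"
proof -
  define S :: "(complex ^ 'd) set" where "S = circle_map ` cube"
  define H where "H z = h (SOME x. x \<in> cube \<and> circle_map x = z)" for z
  have H: "H (circle_map x) = h x" if "x \<in> cube" for x
  proof -
    define y where "y = (SOME y. y \<in> cube \<and> circle_map y = circle_map x)"
    have "y \<in> cube \<and> circle_map y = circle_map x"
      unfolding y_def by (rule someI[of _ x]) (use that in auto)
    then have "h y = h x"
      using circle_map_eq_imp[of y x] bdry[of x] bdry[of y] that by (cases "y = x") simp_all
    then show ?thesis by (simp add: H_def y_def)
  qed
  have "compact S"
    unfolding S_def by (intro compact_continuous_image continuous_circle_map compact_cbox)
  have "continuous_on S H"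
    unfolding continuous_on_closed_vimage[OF compact_imp_closed[OF \<open>compact S\<close>]]
  proof (intro allI impI)
    fix C :: "real set" assume "closed C"
    have "H -` C \<inter> S = circle_map ` (cube \<inter> h -` C)"
      by (auto simp: S_def H)
    moreover have "compact (cube \<inter> h -` C)"
    proof -
      have "closed (h -` C \<inter> cube)"
        using continuous_on_closed_vimage[OF closed_cbox, THEN iffD1, OF h] \<open>closed C\<close> by blast
      then have "compact (cube \<inter> (h -` C \<inter> cube))"
        by (intro compact_Int_closed compact_cbox)
      moreover have "cube \<inter> (h -` C \<inter> cube) = cube \<inter> h -` C" by blast
      ultimately show ?thesis by simp
    qed
    ultimately show "closed (H -` C \<inter> S)"
      by (simp add: compact_continuous_image compact_imp_closed continuous_circle_map)
  qed
  define R where "R = {g. continuous_on S g \<and> trig_poly (\<lambda>x. of_real (g (circle_map x)))}"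
  interpret function_ring_on R S
  proof
    show "compact S" by fact
    show "(\<lambda>_. c) \<in> R" for c by (simp add: R_def trig_poly_const)
    show "\<exists>f\<in>R. f z \<noteq> f w" if "z \<noteq> w" for z w
    proof -
      obtain i where "z $ i \<noteq> w $ i" using \<open>z \<noteq> w\<close> unfolding vec_eq_iff by blast
      then have "Re (z $ i) \<noteq> Re (w $ i) \<or> Im (z $ i) \<noteq> Im (w $ i)" by (auto simp: complex_eq_iff)
      moreover have "(\<lambda>z. Re (z $ i)) \<in> R" "(\<lambda>z. Im (z $ i)) \<in> R"
        by (simp_all add: R_def circle_map_def trig_poly_cos trig_poly_sin continuous_on_Re
            continuous_on_Im continuous_on_component)
      ultimately show ?thesis by (elim disjE) (erule bexI[rotated], assumption)+
    qed
    show "continuous_on S f" if "f \<in> R" for f using that by (simp add: R_def)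
    show "(\<lambda>z. f z + g z) \<in> R" if "f \<in> R" "g \<in> R" for f g
      using that by (simp add: R_def continuous_on_add trig_poly.add)
    show "(\<lambda>z. f z * g z) \<in> R" if "f \<in> R" "g \<in> R" for f g
      using that by (simp add: R_def continuous_on_mult trig_poly_mult)
  qed
  obtain g where g: "g \<in> R" "\<And>z. z \<in> S \<Longrightarrow> \<bar>H z - g z\<bar> < e"
    using Stone_Weierstrass_basic[OF \<open>continuous_on S H\<close> \<open>e > 0\<close>] by blast
  show thesis
  proof
    show "trig_poly (\<lambda>x. of_real (g (circle_map x)))" using g(1) by (simp add: R_def)
    show "cmod (of_real (h x) - of_real (g (circle_map x))) < e" if "x \<in> cube" for x
      using g(2)[of "circle_map x"] that by (simp add: S_def H flip: of_real_diff)
  qed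
qed

lemma integrable_const_torus [simp]:
  fixes c :: "'b :: {banach, second_countable_topology}"
  shows "integrable torus (\<lambda>x. c)"
  by (rule finite_measure.integrable_const[OF finite_measure_torus])

lemma AE_torus_open_cube: "AE x in torus. x \<in> open_cube"
proof -
  have "negligible (cube - open_cube :: (real ^ 'd) set)"
    by (rule negligible_frontier_interval)
  then have "AE x in lebesgue. x \<notin> (cube - open_cube :: (real ^ 'd) set)"
    by (intro AE_not_in) (simp add: negligible_iff_null_sets)
  then show ?thesis
    unfolding torus_def by (subst AE_restrict_space_iff) auto
qed

text \<open>Lebesgue measurable functions are almost everywhere limits of continuous functions. Truncation keeps the
  bound, and a continuous cutoff that tends to 1 inside the cube enforces the boundary condition of
  \<open>trig_poly_uniformly_dense\<close> without changing the limit.\<close>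

lemma torus_approx_by_continuous:
  fixes f :: "real ^ 'd \<Rightarrow> real"
  assumes "f \<in> borel_measurable torus" and bound: "\<And>x. \<bar>f x\<bar> \<le> B"
  obtains h where "\<And>n. continuous_on UNIV (h n)" "\<And>n x. \<bar>h n x\<bar> \<le> B"
    "\<And>n x. x \<in> cube \<Longrightarrow> x \<notin> open_cube \<Longrightarrow> h n x = 0"
    "AE x in torus. (\<lambda>n. h n x) \<longlonglongrightarrow> f x"
proof -
  have "B \<ge> 0" using bound[of 0] by simp
  have "f measurable_on cube"
    using assms(1) by (subst measurable_on_iff_borel_measurable) (simp_all add: torus_def)
  then obtain N g where N: "negligible N" and g: "\<And>n. continuous_on UNIV (g n)"
    "\<And>x. x \<notin> N \<Longrightarrow> (\<lambda>n. g n x) \<longlonglongrightarrow> (if x \<in> cube then f x else 0)"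
    unfolding measurable_on_def by blast
  \<comment> \<open>This product is positive in the open cube and vanishes on the boundary of the cube.\<close>
  define p where "p x = (\<Prod>i\<in>UNIV. 1 + cos (x $ i))" for x :: "real ^ 'd"
  have p_nonneg: "p x \<ge> 0" for x
    unfolding p_def using cos_ge_minus_one by (intro prod_nonneg) (smt (verit))
  define h where "h n x = max (- B) (min B (g n x)) * min 1 (real n * p x)" for n x
  show thesis
  proof
    show "continuous_on UNIV (h n)" for n
      unfolding h_def p_def using g(1)[of n] by (intro continuous_intros) auto
    show "\<bar>h n x\<bar> \<le> B" for n x
    proof -
      have "\<bar>h n x\<bar> \<le> B * 1"
        unfolding h_def abs_mult using \<open>B \<ge> 0\<close> p_nonneg[of x] by (intro mult_mono) auto
      then show ?thesis by simp
    qed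
    show "h n x = 0" if "x \<in> cube" "x \<notin> open_cube" for n x
    proof -
      from that obtain i where "x $ i = pi \<or> x $ i = - pi"
        unfolding mem_box_cart by (metis less_eq_real_def vec_lambda_beta)
      then have "1 + cos (x $ i) = 0" by auto
      then have "p x = 0" unfolding p_def by (intro prod_zero) auto
      then show ?thesis by (simp add: h_def)
    qed
    have "AE x in lebesgue. x \<notin> N"
      using N by (intro AE_not_in) (simp add: negligible_iff_null_sets)
    then have "AE x in torus. x \<notin> N"
      unfolding torus_def by (subst AE_restrict_space_iff) auto
    with AE_torus_open_cube show "AE x in torus. (\<lambda>n. h n x) \<longlonglongrightarrow> f x"
    proof eventually_elim
      case (elim x)
      have "\<bar>x $ i\<bar> < pi" for i using elim(1) unfolding mem_box_cart by (simp add: abs_less_iff minus_less_iff)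
      then have "cos \<bar>x $ i\<bar> > cos pi" for i by (intro cos_monotone_0_pi) auto
      then have "1 + cos (x $ i) > 0" for i by (smt (verit) cos_abs_real cos_pi)
      then have "p x > 0" unfolding p_def by (intro prod_pos) blast
      have "eventually (\<lambda>n. real n > 1 / p x) sequentially"
        using eventually_gt_at_top filterlim_real_sequentially
        by (auto simp: filterlim_at_top_dense)
      then have "(\<lambda>n. min 1 (real n * p x)) \<longlonglongrightarrow> 1"
        using \<open>p x > 0\<close> by (intro tendsto_eventually) (auto elim!: eventually_mono simp: field_simps)
      moreover have "x \<in> cube" using elim(1) box_subset_cbox by blast
      then have "(\<lambda>n. g n x) \<longlonglongrightarrow> f x" using g(2)[OF elim(2)] by simp
      ultimately have "(\<lambda>n. h n x) \<longlonglongrightarrow> max (- B) (min B (f x)) * 1"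
        unfolding h_def by (intro tendsto_intros)
      moreover have "max (- B) (min B (f x)) = f x" using bound[of x] by auto
      ultimately show ?case by simp
    qed
  qed
qed

lemma integrable_trig_approx:
  fixes f :: "real ^ 'd \<Rightarrow> real"
  assumes "f \<in> L2" "T \<in> borel_measurable torus" "\<And>x. cmod (T x) \<le> C"
  shows "integrable torus (\<lambda>x. (cmod (of_real (f x) - T x))\<^sup>2)"
proof (rule Bochner_Integration.integrable_bound)
  show "integrable torus (\<lambda>x. 2 * (f x)\<^sup>2 + 2 * C\<^sup>2)"
    using assms(1) unfolding L2_def
    by (intro Bochner_Integration.integrable_add integrable_mult_right
        integrable_const_torus) simp
  have [measurable]: "f \<in> borel_measurable torus" using assms(1) by (simp add: L2_def)
  note assms(2)[measurable]
  show "(\<lambda>x. (cmod (of_real (f x) - T x))\<^sup>2) \<in> borel_measurable torus" by measurable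
  show "AE x in torus. norm ((cmod (of_real (f x) - T x))\<^sup>2) \<le> norm (2 * (f x)\<^sup>2 + 2 * C\<^sup>2)"
  proof (rule AE_I2)
    fix x
    have "cmod (of_real (f x) - T x) \<le> \<bar>f x\<bar> + C"
      using norm_triangle_ineq4[of "of_real (f x)" "T x"] assms(3)[of x] by simp
    then have "(cmod (of_real (f x) - T x))\<^sup>2 \<le> (\<bar>f x\<bar> + C)\<^sup>2"
      by (intro power_mono) auto
    also have "\<dots> \<le> 2 * (f x)\<^sup>2 + 2 * C\<^sup>2"
      using sum_squares_bound[of "\<bar>f x\<bar>" C] by (simp add: power2_sum)
    finally show "norm ((cmod (of_real (f x) - T x))\<^sup>2) \<le> norm (2 * (f x)\<^sup>2 + 2 * C\<^sup>2)"
      by simp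
  qed
qed

lemma trig_poly_bounded:
  assumes "trig_poly T"
  obtains C where "\<And>x. cmod (T x) \<le> C"
proof -
  have "\<exists>C. \<forall>x. cmod (T x) \<le> C"
    using assms
  proof induction
    case (monomial c k)
    then show ?case by (auto simp: norm_mult)
  next
    case (add f g)
    then obtain C D where "\<And>x. cmod (f x) \<le> C" "\<And>x. cmod (g x) \<le> D" by blast
    then have "cmod (f x + g x) \<le> C + D" for x
      by (intro order.trans[OF norm_triangle_ineq] add_mono)
    then show ?case by blast
  qed
  with that show thesis by blast
qed

text \<open>Dominated convergence turns the almost everywhere approximation by continuous functions into one in
  \<open>L\<^sup>2\<close>, and uniform approximation on a set of finite measure is approximation in \<open>L\<^sup>2\<close>.\<close>

lemma trig_poly_L2_dense_bounded:
  fixes f :: "real ^ 'd \<Rightarrow> real"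
  assumes f [measurable]: "f \<in> borel_measurable torus" and bound: "\<And>x. \<bar>f x\<bar> \<le> B" and "e > 0"
  obtains T where "trig_poly T" "(LINT x|torus. (cmod (of_real (f x) - T x))\<^sup>2) < e"
proof -
  obtain h where h: "\<And>n. continuous_on UNIV (h n)" "\<And>n x. \<bar>h n x\<bar> \<le> B"
    "\<And>n x. x \<in> cube \<Longrightarrow> x \<notin> open_cube \<Longrightarrow> h n x = 0"
    "AE x in torus. (\<lambda>n. h n x) \<longlonglongrightarrow> f x"
    using torus_approx_by_continuous[OF f bound] by blast
  have [measurable]: "h n \<in> borel_measurable torus" for n
    by (intro borel_imp_torus_measurable borel_measurable_continuous_onI h(1))
  have diff_bound: "(f x - h n x)\<^sup>2 \<le> (2 * B)\<^sup>2" for n x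
    using bound[of x] h(2)[of n x] by (intro power2_le_iff_abs_le[THEN iffD2]) auto
  have "(\<lambda>n. LINT x|torus. (f x - h n x)\<^sup>2) \<longlonglongrightarrow> (LINT x|(torus :: (real^'d) measure). 0)"
  proof (rule integral_dominated_convergence[where w="\<lambda>_. (2 * B)\<^sup>2"])
    show "AE x in torus. (\<lambda>n. (f x - h n x)\<^sup>2) \<longlonglongrightarrow> 0"
      using h(4)
    proof eventually_elim
      case (elim x)
      then have "(\<lambda>n. (f x - h n x)\<^sup>2) \<longlonglongrightarrow> (f x - f x)\<^sup>2" by (intro tendsto_intros)
      then show ?case by simp
    qed
  qed (use diff_bound in \<open>auto intro: integrable_const_torus\<close>)
  then have "eventually (\<lambda>n. (LINT x|torus. (f x - h n x)\<^sup>2) < e / 4) sequentially"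
    by (rule order_tendstoD(2)) (use \<open>e > 0\<close> in simp)
  then obtain n where n: "(LINT x|torus. (f x - h n x)\<^sup>2) < e / 4"
    unfolding eventually_sequentially by blast
  define V where "V = measure torus (space (torus :: (real ^ 'd) measure))"
  have "V \<ge> 0" by (simp add: V_def)
  define \<delta> where "\<delta> = sqrt (e / (4 * (V + 1)))"
  have "\<delta> > 0" using \<open>e > 0\<close> \<open>V \<ge> 0\<close> by (simp add: \<delta>_def)
  obtain T where T: "trig_poly T" "\<And>x. x \<in> cube \<Longrightarrow> cmod (of_real (h n x) - T x) < \<delta>"
    using trig_poly_uniformly_dense[OF continuous_on_subset[OF h(1)[of n] subset_UNIV] h(3)[where n=n] \<open>\<delta> > 0\<close>]
    by blast
  obtain C where C: "\<And>x. cmod (T x) \<le> C" using trig_poly_bounded[OF T(1)] by blast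
  have "(f x)\<^sup>2 \<le> B\<^sup>2" for x
    using order_trans[OF bound abs_ge_self] by (simp add: abs_le_square_iff[symmetric])
  then have "f \<in> L2"
    unfolding L2_def by (auto intro!: integrable_bounded_torus[where B="B\<^sup>2"])
  have int1: "integrable torus (\<lambda>x. (f x - h n x)\<^sup>2)"
    by (rule integrable_bounded_torus[where B="(2*B)\<^sup>2"]) (use diff_bound in auto)
  have intc: "integrable torus (\<lambda>x::real^'d. 2 * \<delta>\<^sup>2)"
    using integrable_const_torus .
  have "(LINT x|torus. (cmod (of_real (f x) - T x))\<^sup>2)
      \<le> (LINT x|torus. 2 * (f x - h n x)\<^sup>2 + 2 * \<delta>\<^sup>2)"
  proof (rule integral_mono)
    show "integrable torus (\<lambda>x. (cmod (of_real (f x) - T x))\<^sup>2)"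
      by (rule integrable_trig_approx[OF \<open>f \<in> L2\<close> borel_measurable_trig_poly[OF T(1)] C])
    show "integrable torus (\<lambda>x. 2 * (f x - h n x)\<^sup>2 + 2 * \<delta>\<^sup>2)"
      using int1 intc by simp
    fix x :: "real ^ 'd" assume "x \<in> space torus"
    then have *: "cmod (of_real (h n x) - T x) < \<delta>" using T(2) by (simp add: space_torus)
    have "cmod (of_real (f x) - T x)
        \<le> cmod (of_real (f x) - of_real (h n x)) + cmod (of_real (h n x) - T x)"
      using norm_triangle_ineq[of "of_real (f x) - of_real (h n x)" "of_real (h n x) - T x"] by simp
    also have "\<dots> \<le> \<bar>f x - h n x\<bar> + \<delta>" using * by (simp flip: of_real_diff)
    finally have "(cmod (of_real (f x) - T x))\<^sup>2 \<le> (\<bar>f x - h n x\<bar> + \<delta>)\<^sup>2"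
      by (intro power_mono) auto
    also have "\<dots> \<le> 2 * (f x - h n x)\<^sup>2 + 2 * \<delta>\<^sup>2"
      using sum_squares_bound[of "\<bar>f x - h n x\<bar>" \<delta>] by (simp add: power2_sum)
    finally show "(cmod (of_real (f x) - T x))\<^sup>2 \<le> 2 * (f x - h n x)\<^sup>2 + 2 * \<delta>\<^sup>2" .
  qed
  also have "\<dots> = 2 * (LINT x|torus. (f x - h n x)\<^sup>2) + 2 * \<delta>\<^sup>2 * V"
    using int1 intc by (simp add: V_def mult.commute)
  also have "\<dots> < 2 * (e / 4) + e / 2"
  proof -
    have "2 * \<delta>\<^sup>2 * V \<le> e / 2"
      using \<open>V \<ge> 0\<close> \<open>e > 0\<close> by (simp add: \<delta>_def field_simps)
    with n show ?thesis by linarith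
  qed
  finally have "(LINT x|torus. (cmod (of_real (f x) - T x))\<^sup>2) < e" by simp
  with T(1) that show thesis by blast
qed

text \<open>Truncating \<open>f\<close> at height \<open>n\<close> reduces the claim to bounded functions.\<close>

lemma trig_poly_L2_dense:
  fixes f :: "real ^ 'd \<Rightarrow> real"
  assumes f: "f \<in> L2" and "e > 0"
  obtains T where "trig_poly T" "(LINT x|torus. (cmod (of_real (f x) - T x))\<^sup>2) < e"
proof -
  have [measurable]: "f \<in> borel_measurable torus" and f2: "integrable torus (\<lambda>x. (f x)\<^sup>2)"
    using f by (simp_all add: L2_def)
  define g where "g n x = max (- real n) (min (real n) (f x))" for n x
  have [measurable]: "g n \<in> borel_measurable torus" for n unfolding g_def by measurable
  have g_le: "(f x - g n x)\<^sup>2 \<le> (f x)\<^sup>2" for n x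
    by (rule abs_le_square_iff[THEN iffD1]) (auto simp: g_def)
  have "(\<lambda>n. LINT x|torus. (f x - g n x)\<^sup>2) \<longlonglongrightarrow> (LINT x|(torus :: (real^'d) measure). 0)"
  proof (rule integral_dominated_convergence[where w="\<lambda>x. (f x)\<^sup>2"])
    show "AE x in torus. (\<lambda>n. (f x - g n x)\<^sup>2) \<longlonglongrightarrow> 0"
    proof (rule AE_I2)
      fix x
      have "eventually (\<lambda>n. real n > \<bar>f x\<bar>) sequentially"
        using filterlim_real_sequentially by (auto simp: filterlim_at_top_dense)
      then show "(\<lambda>n. (f x - g n x)\<^sup>2) \<longlonglongrightarrow> 0"
        by (intro tendsto_eventually) (auto elim!: eventually_mono simp: g_def)
    qed
  qed (use g_le f2 in simp_all)
  then have "eventually (\<lambda>n. (LINT x|torus. (f x - g n x)\<^sup>2) < e / 4) sequentially"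
    by (rule order_tendstoD(2)) (use \<open>e > 0\<close> in simp)
  then obtain n where n: "(LINT x|torus. (f x - g n x)\<^sup>2) < e / 4"
    unfolding eventually_sequentially by blast
  obtain T where T: "trig_poly T" "(LINT x|torus. (cmod (of_real (g n x) - T x))\<^sup>2) < e / 4"
    by (rule trig_poly_L2_dense_bounded[of "g n" "real n" "e / 4"])
      (use \<open>e > 0\<close> in \<open>auto simp: g_def\<close>)
  obtain C where C: "\<And>x. cmod (T x) \<le> C" using trig_poly_bounded[OF T(1)] by blast
  have "g n \<in> L2"
    unfolding L2_def
    by (auto intro!: integrable_bounded_torus[where B="(real n)\<^sup>2"] abs_le_square_iff[THEN iffD1] simp: g_def)
  have int1: "integrable torus (\<lambda>x. (f x - g n x)\<^sup>2)"
    by (rule Bochner_Integration.integrable_bound[OF f2]) (use g_le in auto)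
  have int2: "integrable torus (\<lambda>x. (cmod (of_real (g n x) - T x))\<^sup>2)"
    by (rule integrable_trig_approx[OF \<open>g n \<in> L2\<close> borel_measurable_trig_poly[OF T(1)] C])
  have "(LINT x|torus. (cmod (of_real (f x) - T x))\<^sup>2)
      \<le> (LINT x|torus. 2 * (f x - g n x)\<^sup>2 + 2 * (cmod (of_real (g n x) - T x))\<^sup>2)"
  proof (rule integral_mono)
    show "integrable torus (\<lambda>x. (cmod (of_real (f x) - T x))\<^sup>2)"
      by (rule integrable_trig_approx[OF f borel_measurable_trig_poly[OF T(1)] C])
    show "integrable torus (\<lambda>x. 2 * (f x - g n x)\<^sup>2 + 2 * (cmod (of_real (g n x) - T x))\<^sup>2)"
      using int1 int2 by simp
    fix x
    have "cmod (of_real (f x) - T x)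
        \<le> cmod (of_real (f x) - of_real (g n x)) + cmod (of_real (g n x) - T x)"
      using norm_triangle_ineq[of "of_real (f x) - of_real (g n x)" "of_real (g n x) - T x"] by simp
    then have "(cmod (of_real (f x) - T x))\<^sup>2 \<le> (\<bar>f x - g n x\<bar> + cmod (of_real (g n x) - T x))\<^sup>2"
      by (intro power_mono) (auto simp flip: of_real_diff)
    also have "\<dots> \<le> 2 * (f x - g n x)\<^sup>2 + 2 * (cmod (of_real (g n x) - T x))\<^sup>2"
      using sum_squares_bound[of "\<bar>f x - g n x\<bar>" "cmod (of_real (g n x) - T x)"]
      by (simp add: power2_sum)
    finally show "(cmod (of_real (f x) - T x))\<^sup>2
        \<le> 2 * (f x - g n x)\<^sup>2 + 2 * (cmod (of_real (g n x) - T x))\<^sup>2" .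
  qed
  also have "\<dots> = 2 * (LINT x|torus. (f x - g n x)\<^sup>2)
      + 2 * (LINT x|torus. (cmod (of_real (g n x) - T x))\<^sup>2)"
    using int1 int2 by simp
  also have "\<dots> < e" using n T(2) by simp
  finally show thesis using T(1) that by blast
qed

section \<open>Parseval's identity\<close>

lemma L2_measurable: "u \<in> L2 \<Longrightarrow> u \<in> borel_measurable torus"
  and L2_square_integrable: "u \<in> L2 \<Longrightarrow> integrable torus (\<lambda>x. (u x)\<^sup>2)"
  by (simp_all add: L2_def)

lemma L2_mult_integrable:
  assumes "u \<in> L2" "v \<in> L2"
  shows "integrable torus (\<lambda>x. u x * v x)"
proof (rule Bochner_Integration.integrable_bound)
  show "integrable torus (\<lambda>x. (u x)\<^sup>2 + (v x)\<^sup>2)"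
    using assms by (simp add: L2_def)
  show "(\<lambda>x. u x * v x) \<in> borel_measurable torus"
    using assms by (intro borel_measurable_times) (simp_all add: L2_def)
  show "AE x in torus. norm (u x * v x) \<le> norm ((u x)\<^sup>2 + (v x)\<^sup>2)"
  proof (rule AE_I2)
    fix x
    have "2 * \<bar>u x\<bar> * \<bar>v x\<bar> \<le> (u x)\<^sup>2 + (v x)\<^sup>2"
      using sum_squares_bound[of "\<bar>u x\<bar>" "\<bar>v x\<bar>"] by simp
    moreover have "\<bar>u x\<bar> * \<bar>v x\<bar> \<ge> 0" by simp
    ultimately have "\<bar>u x\<bar> * \<bar>v x\<bar> \<le> (u x)\<^sup>2 + (v x)\<^sup>2" by linarith
    then show "norm (u x * v x) \<le> norm ((u x)\<^sup>2 + (v x)\<^sup>2)"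
      by (simp add: abs_mult)
  qed
qed

lemma L2_const [simp]: "(\<lambda>x. c) \<in> L2"
  by (simp add: L2_def)

lemma L2_integrable:
  assumes "u \<in> L2"
  shows "integrable torus u"
  using L2_mult_integrable[OF assms L2_const[of 1]] by simp

lemma L2_wave_integrable:
  assumes "u \<in> L2"
  shows "integrable torus (\<lambda>x. of_real (u x) * cnj (wave k x))"
proof (rule Bochner_Integration.integrable_bound[OF L2_integrable[OF assms]])
  note L2_measurable[OF assms, measurable]
  show "(\<lambda>x. of_real (u x) * cnj (wave k x)) \<in> borel_measurable torus"
    unfolding wave_uminus[symmetric] by measurable
qed (simp add: norm_mult)

lemma fourier_coeff_eq:
  fixes u :: "real ^ 'd \<Rightarrow> real"
  shows "(LINT x|torus. of_real (u x) * cnj (wave k x)) = of_real (torus_volume TYPE('d)) * fourier_coeff u k"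
proof -
  have "exp (- (\<i> * of_real (freq k \<bullet> x))) = cnj (wave k x)" for x
    by (simp add: wave_def exp_cnj)
  then show ?thesis by (simp add: fourier_coeff_def)
qed

text \<open>Completing the square: the error is smallest when the \<open>c k\<close> are the Fourier coefficients. That special
  case gives Bessel's inequality; the general one compares an arbitrary trigonometric approximation with
  the Fourier sum over the same frequencies.\<close>

lemma trig_approximation_error:
  fixes f :: "real ^ 'd \<Rightarrow> real"
  assumes f: "f \<in> L2" and "finite A"
  shows "(LINT x|torus. (cmod (of_real (f x) - (\<Sum>k\<in>A. c k * wave k x)))\<^sup>2)
    = (LINT x|torus. (f x)\<^sup>2) + torus_volume TYPE('d) *
        (\<Sum>k\<in>A. (cmod (fourier_coeff f k - c k))\<^sup>2 - (cmod (fourier_coeff f k))\<^sup>2)"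
proof -
  let ?V = "torus_volume TYPE('d)"
  let ?T = "\<lambda>x. \<Sum>k\<in>A. c k * wave k x"
  define P where "P x = (\<Sum>k\<in>A. cnj (c k) * (of_real (f x) * cnj (wave k x)))" for x
  define Q where "Q x = (\<Sum>k\<in>A. \<Sum>l\<in>A. (c k * cnj (c l)) * wave (k - l) x)" for x :: "real ^ 'd"
  have split: "(cmod (of_real (f x) - ?T x))\<^sup>2 = (f x)\<^sup>2 - 2 * Re (P x) + Re (Q x)" for x
  proof -
    have "P x = of_real (f x) * cnj (?T x)"
      by (simp add: P_def cnj_sum sum_distrib_left mult_ac)
    moreover have "Q x = ?T x * cnj (?T x)"
      by (simp add: Q_def wave_mult_cnj[symmetric] cnj_sum sum_product mult_ac)
    moreover have "(cmod (of_real a - t))\<^sup>2 = a\<^sup>2 - 2 * Re (of_real a * cnj t) + Re (t * cnj t)" for a t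
      unfolding cmod_power2 by (simp add: power2_eq_square algebra_simps)
    ultimately show ?thesis by metis
  qed
  have int_P: "integrable torus P"
    unfolding P_def by (intro Bochner_Integration.integrable_sum integrable_mult_right L2_wave_integrable f)
  have int_wave: "integrable torus (wave k)" for k :: "int ^ 'd"
    by (rule integrable_bounded_torus[where B=1]) auto
  have int_Q: "integrable torus Q"
    unfolding Q_def by (intro Bochner_Integration.integrable_sum integrable_mult_right int_wave)
  define a where "a k = Re (cnj (c k) * (of_real ?V * fourier_coeff f k))" for k
  define b where "b k = Re ((c k * cnj (c k)) * of_real ?V)" for k
  have "(LINT x|torus. P x) = (\<Sum>k\<in>A. cnj (c k) * (of_real ?V * fourier_coeff f k))"
    unfolding P_def
    by (simp add: Bochner_Integration.integral_sum L2_wave_integrable f fourier_coeff_eq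
        del: of_real_power of_real_mult)
  then have P: "Re (LINT x|torus. P x) = (\<Sum>k\<in>A. a k)"
    by (simp only: Re_sum a_def)
  have "(LINT x|torus. Q x) = (\<Sum>k\<in>A. \<Sum>l\<in>A. (c k * cnj (c l)) * (if k - l = 0 then of_real ?V else 0))"
    unfolding Q_def
    by (simp add: Bochner_Integration.integral_sum int_wave integral_wave
        del: of_real_power of_real_mult right_minus_eq)
  also have "\<dots> = (\<Sum>k\<in>A. (c k * cnj (c k)) * of_real ?V)"
    using \<open>finite A\<close> by (simp add: if_distrib[where f="\<lambda>x. _ * x"] sum.delta cong: if_cong)
  finally have Q: "Re (LINT x|torus. Q x) = (\<Sum>k\<in>A. b k)"
    by (simp only: Re_sum b_def)
  have "?V * ((cmod (fourier_coeff f k - c k))\<^sup>2 - (cmod (fourier_coeff f k))\<^sup>2) = - 2 * a k + b k" for k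
    unfolding cmod_power2 a_def b_def
    by (simp add: power2_eq_square algebra_simps del: of_real_power of_real_mult)
  then have "?V * (\<Sum>k\<in>A. (cmod (fourier_coeff f k - c k))\<^sup>2 - (cmod (fourier_coeff f k))\<^sup>2)
      = - 2 * (\<Sum>k\<in>A. a k) + (\<Sum>k\<in>A. b k)"
    by (simp only: sum_distrib_left sum.distrib)
  moreover have "(LINT x|torus. (cmod (of_real (f x) - ?T x))\<^sup>2)
      = (LINT x|torus. (f x)\<^sup>2) - 2 * Re (LINT x|torus. P x) + Re (LINT x|torus. Q x)"
    unfolding split integral_Re[OF int_P, symmetric] integral_Re[OF int_Q, symmetric]
    using L2_square_integrable[OF f] integrable_Re[OF int_P] integrable_Re[OF int_Q] by simp
  ultimately show ?thesis
    using P Q by linarith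
qed

text \<open>Finite partial sums stay below the limit by Bessel's inequality and come arbitrarily close to it because
  trigonometric polynomials are dense.\<close>

theorem parseval:
  fixes f :: "real ^ 'd \<Rightarrow> real"
  assumes f: "f \<in> L2"
  shows "((\<lambda>k. (cmod (fourier_coeff f k))\<^sup>2) has_sum
    (LINT x|torus. (f x)\<^sup>2) / torus_volume TYPE('d)) UNIV"
proof -
  let ?V = "torus_volume TYPE('d)" and ?I = "LINT x|torus. (f x)\<^sup>2"
  let ?s = "\<lambda>A. \<Sum>k\<in>A. (cmod (fourier_coeff f k))\<^sup>2"
  have "?V > 0" by simp
  have bessel: "?V * ?s A \<le> ?I" if "finite A" for A
  proof -
    have "0 \<le> (LINT x|torus. (cmod (of_real (f x) - (\<Sum>k\<in>A. fourier_coeff f k * wave k x)))\<^sup>2)"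
      by (rule Bochner_Integration.integral_nonneg) simp
    also have "\<dots> = ?I - ?V * ?s A"
      by (subst trig_approximation_error[OF f that]) (simp add: sum_negf)
    finally show ?thesis by simp
  qed
  have dense: "\<exists>A. finite A \<and> ?I - ?V * ?s A < e" if "e > 0" for e
  proof -
    obtain T where T: "trig_poly T" "(LINT x|torus. (cmod (of_real (f x) - T x))\<^sup>2) < e"
      using trig_poly_L2_dense[OF f \<open>e > 0\<close>] by blast
    obtain A c where A: "finite A" "\<And>x. T x = (\<Sum>k\<in>A. c k * wave k x)"
      using trig_poly_expansion[OF T(1)] by blast
    have "?V * (\<Sum>k\<in>A. (cmod (fourier_coeff f k - c k))\<^sup>2) \<ge> 0" by (simp add: sum_nonneg)
    then have "?I - ?V * ?s A \<le> (LINT x|torus. (cmod (of_real (f x) - T x))\<^sup>2)"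
      unfolding A(2) trig_approximation_error[OF f A(1)]
      by (simp add: sum_subtractf right_diff_distrib)
    with T(2) A(1) show ?thesis by (intro exI[of _ A]) simp
  qed
  show ?thesis
    unfolding has_sum_def
  proof (rule tendstoI)
    fix e :: real assume "e > 0"
    then obtain A where A: "finite A" "?I - ?V * ?s A < ?V * e"
      using dense[of "?V * e"] \<open>?V > 0\<close> by auto
    show "\<forall>\<^sub>F B in finite_subsets_at_top UNIV. dist (?s B) (?I / ?V) < e"
      unfolding eventually_finite_subsets_at_top
    proof (intro exI[of _ A] conjI allI impI A(1) subset_UNIV)
      fix B :: "(int ^ 'd) set" assume B: "finite B \<and> A \<subseteq> B \<and> B \<subseteq> UNIV"
      then have "?s A \<le> ?s B" by (intro sum_mono2) auto
      then have "?V * ?s A \<le> ?V * ?s B" using \<open>?V > 0\<close> by (intro mult_left_mono) auto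
      with A(2) have "?I - ?V * ?s B < ?V * e" by linarith
      then have "?I / ?V - ?s B < e" using \<open>?V > 0\<close> by (simp add: field_simps)
      moreover have "?I / ?V - ?s B \<ge> 0" using bessel[of B] B \<open>?V > 0\<close> by (simp add: field_simps)
      ultimately show "dist (?s B) (?I / ?V) < e" by (simp add: dist_real_def)
    qed
  qed
qed

section \<open>Stability of the implicit midpoint scheme\<close>

lemma L2_add: "u \<in> L2 \<Longrightarrow> v \<in> L2 \<Longrightarrow> (\<lambda>x. u x + v x) \<in> L2"
  using L2_mult_integrable[of u v] borel_measurable_add[of u torus v]
  by (simp add: L2_def power2_sum mult.assoc)

lemma L2_cmult: "u \<in> L2 \<Longrightarrow> (\<lambda>x. c * u x) \<in> L2"
  using borel_measurable_times[of "\<lambda>_. c" torus u] by (simp add: L2_def power_mult_distrib)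

lemma L2_diff: "u \<in> L2 \<Longrightarrow> v \<in> L2 \<Longrightarrow> (\<lambda>x. u x - v x) \<in> L2"
  using L2_add[of u "\<lambda>x. - 1 * v x"] L2_cmult[of v "- 1"] by simp

lemma L2_norm_nonneg: "L2_norm u \<ge> 0"
  by (simp add: L2_norm_def)

lemma L2_norm_square: "(L2_norm u)\<^sup>2 = (LINT x|torus. (u x)\<^sup>2)"
  by (simp add: L2_norm_def)

lemma fourier_coeff_add:
  assumes "u \<in> L2" "v \<in> L2"
  shows "fourier_coeff (\<lambda>x. u x + v x) k = fourier_coeff u k + fourier_coeff v k"
proof -
  have "(LINT x|torus. of_real (u x + v x) * cnj (wave k x))
      = (LINT x|torus. of_real (u x) * cnj (wave k x) + of_real (v x) * cnj (wave k x))"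
    by (simp add: distrib_right)
  also have "\<dots> = (LINT x|torus. of_real (u x) * cnj (wave k x))
      + (LINT x|torus. of_real (v x) * cnj (wave k x))"
    by (intro Bochner_Integration.integral_add L2_wave_integrable assms)
  finally show ?thesis
    unfolding fourier_coeff_eq distrib_left[symmetric] by simp
qed

lemma fourier_coeff_diff:
  assumes "u \<in> L2" "v \<in> L2"
  shows "fourier_coeff (\<lambda>x. u x - v x) k = fourier_coeff u k - fourier_coeff v k"
  using fourier_coeff_add[OF L2_diff[OF assms] assms(2)] by simp

lemma fourier_coeff_0 [simp]: "fourier_coeff (\<lambda>x. 0) k = 0"
  by (simp add: fourier_coeff_def)

lemma has_laplacian_diff:
  assumes "has_laplacian u g" "has_laplacian v h"
  shows "has_laplacian (\<lambda>x. u x - v x) (\<lambda>x. g x - h x)"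
  using assms unfolding has_laplacian_def
  by (simp add: L2_diff fourier_coeff_diff right_diff_distrib)

lemma has_laplacian_laplacian: "u \<in> laplacian_dom \<Longrightarrow> has_laplacian u (laplacian u)"
  unfolding laplacian_dom_def mem_Collect_eq laplacian_def[of u] by (erule someI_ex)

text \<open>By polarization the claim compares the norms of \<open>g + u\<close> and \<open>g - u\<close>. With \<open>l = |k|\<^sup>2\<close> their Fourier coefficients
  are those of \<open>u\<close> times \<open>1 - l\<close> and \<open>- (1 + l)\<close>, and \<open>|1 - l| \<le> 1 + l\<close>, so Parseval's identity decides the
  comparison.\<close>

lemma laplacian_dissipative:
  fixes u :: "real ^ 'd \<Rightarrow> real"
  assumes "has_laplacian u g"
  shows "(LINT x|torus. g x * u x) \<le> 0"
proof -
  let ?V = "torus_volume TYPE('d)"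
  have L2: "u \<in> L2" "g \<in> L2" and
    g: "fourier_coeff g k = - of_real ((norm (freq k))\<^sup>2) * fourier_coeff u k" for k
    using assms by (auto simp: has_laplacian_def)
  have "(LINT x|torus. (g x + u x)\<^sup>2) / ?V \<le> (LINT x|torus. (g x - u x)\<^sup>2) / ?V"
  proof (rule has_sum_mono)
    show "((\<lambda>k. (cmod (fourier_coeff (\<lambda>x. g x + u x) k))\<^sup>2) has_sum
        (LINT x|torus. (g x + u x)\<^sup>2) / ?V) UNIV"
      by (intro parseval L2_add L2)
    show "((\<lambda>k. (cmod (fourier_coeff (\<lambda>x. g x - u x) k))\<^sup>2) has_sum
        (LINT x|torus. (g x - u x)\<^sup>2) / ?V) UNIV"
      by (intro parseval L2_diff L2)
    show "(cmod (fourier_coeff (\<lambda>x. g x + u x) k))\<^sup>2 \<le> (cmod (fourier_coeff (\<lambda>x. g x - u x) k))\<^sup>2" for k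
    proof -
      define l where "l = (norm (freq k))\<^sup>2"
      have "l \<ge> 0" by (simp add: l_def)
      have "fourier_coeff (\<lambda>x. g x + u x) k = of_real (1 - l) * fourier_coeff u k"
        unfolding fourier_coeff_add[OF L2(2,1)] g l_def by (simp add: algebra_simps)
      then have "cmod (fourier_coeff (\<lambda>x. g x + u x) k) = \<bar>1 - l\<bar> * cmod (fourier_coeff u k)"
        by (simp only: norm_mult norm_of_real)
      moreover have "fourier_coeff (\<lambda>x. g x - u x) k = of_real (- (1 + l)) * fourier_coeff u k"
        unfolding fourier_coeff_diff[OF L2(2,1)] g l_def by (simp add: algebra_simps)
      then have "cmod (fourier_coeff (\<lambda>x. g x - u x) k) = \<bar>- (1 + l)\<bar> * cmod (fourier_coeff u k)"
        by (simp only: norm_mult norm_of_real)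
      ultimately show ?thesis
        using \<open>l \<ge> 0\<close> by (intro power_mono) (auto intro!: mult_right_mono)
    qed
  qed
  moreover have "?V > 0" by simp
  ultimately have le: "(LINT x|torus. (g x + u x)\<^sup>2) \<le> (LINT x|torus. (g x - u x)\<^sup>2)"
    by (simp only: divide_le_cancel)
  have "(LINT x|torus. (g x + u x)\<^sup>2) - (LINT x|torus. (g x - u x)\<^sup>2)
      = (LINT x|torus. (g x + u x)\<^sup>2 - (g x - u x)\<^sup>2)"
    by (intro Bochner_Integration.integral_diff[symmetric] L2_square_integrable L2_add L2_diff L2)
  also have "\<dots> = (LINT x|torus. 4 * (g x * u x))"
    by (intro Bochner_Integration.integral_cong) (simp_all add: power2_eq_square algebra_simps)
  also have "\<dots> = 4 * (LINT x|torus. g x * u x)" by simp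
  finally show ?thesis using le by linarith
qed

lemma midpoint_L2: "u \<in> L2 \<Longrightarrow> v \<in> L2 \<Longrightarrow> midpoint u v \<in> L2"
  using L2_cmult[OF L2_add, of u v "1/2"] by (simp add: midpoint_def field_simps)

lemma cube_diff_mult_nonneg: "(a ^ 3 - b ^ 3) * (a - b) \<ge> (0 :: real)"
proof -
  have "(a ^ 3 - b ^ 3) * (a - b) = (a - b)\<^sup>2 * ((a + b / 2)\<^sup>2 + 3 / 4 * b\<^sup>2)"
    by (simp add: power2_eq_square power3_eq_cube algebra_simps)
  then show ?thesis by simp
qed

text \<open>The pointwise energy balance at one point of the torus: \<open>d\<close> and \<open>e\<close> are the differences of old and new
  values, \<open>z\<close>, \<open>G\<close> and \<open>K\<close> those of the midpoints, their Laplacians and their cubes, \<open>\<rho>\<close> that of the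
  residuals. Multiplying \<open>\<rho>\<close> by \<open>2 * z = d + e\<close> produces \<open>d\<^sup>2 - e\<^sup>2\<close>. The terms \<open>2 * \<tau> * z\<^sup>2\<close> and \<open>2 * \<rho> * z\<close>
  together cost at most \<open>2 * \<rho>\<^sup>2 + z\<^sup>2\<close>, and \<open>z\<^sup>2 \<le> (d\<^sup>2 + e\<^sup>2) / 2\<close> lets half of \<open>e\<^sup>2\<close> absorb its share. Dropping
  the cubes pointwise leaves only products of functions in \<open>L2\<close> to integrate.\<close>

lemma energy_inequality:
  fixes z e d \<rho> G K \<tau> c :: real
  assumes "0 < \<tau>" "\<tau> \<le> 1 / 4"
    and z: "z = (d + e) / 2" and K: "K * z \<ge> 0"
    and \<rho>: "\<rho> = d - e + \<tau> * (c * G - K + z)"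
  shows "e\<^sup>2 \<le> 3 * d\<^sup>2 + 4 * \<rho>\<^sup>2 + 4 * (\<tau> * c * (G * z))"
proof -
  have "2 * (\<rho> * z) = (d\<^sup>2 - e\<^sup>2) + 2 * (\<tau> * c * (G * z)) - 2 * (\<tau> * (K * z)) + 2 * (\<tau> * z\<^sup>2)"
    unfolding \<rho> z by (simp add: power2_eq_square field_simps)
  moreover have "\<tau> * (K * z) \<ge> 0" using assms by simp
  moreover have "4 * (\<tau> * z\<^sup>2) \<le> z\<^sup>2" using mult_right_mono[OF assms(2), of "z\<^sup>2"] by simp
  moreover have "4 * \<rho>\<^sup>2 + z\<^sup>2 + 4 * (\<rho> * z) = (2 * \<rho> + z)\<^sup>2"
    by (simp add: power2_eq_square algebra_simps)
  then have "0 \<le> 4 * \<rho>\<^sup>2 + z\<^sup>2 + 4 * (\<rho> * z)" by simp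
  moreover have "d\<^sup>2 + e\<^sup>2 - 2 * z\<^sup>2 = (d - e)\<^sup>2 / 2"
    unfolding z by (simp add: power2_eq_square field_simps)
  then have "2 * z\<^sup>2 \<le> d\<^sup>2 + e\<^sup>2" using zero_le_power2[of "d - e"] by linarith
  ultimately show ?thesis by linarith
qed

lemma midpoint_scheme_stability:
  fixes u1 u2 v1 v2 :: "real ^ 'd \<Rightarrow> real"
  assumes \<tau>: "0 < \<tau>" "\<tau> \<le> 1 / 4"
    and L2: "u1 \<in> L2" "u2 \<in> L2" "v1 \<in> L2" "v2 \<in> L2"
    and dom: "midpoint u1 v1 \<in> laplacian_dom" "midpoint u2 v2 \<in> laplacian_dom"
    and res: "(\<lambda>x. Psi \<epsilon>AC \<tau> u1 v1 x - v1 x) \<in> L2" "(\<lambda>x. Psi \<epsilon>AC \<tau> u2 v2 x - v2 x) \<in> L2"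
  shows "(L2_norm (\<lambda>x. v1 x - v2 x))\<^sup>2 \<le> 3 * (L2_norm (\<lambda>x. u1 x - u2 x))\<^sup>2 +
    4 * (L2_norm (\<lambda>x. (Psi \<epsilon>AC \<tau> u1 v1 x - v1 x) - (Psi \<epsilon>AC \<tau> u2 v2 x - v2 x)))\<^sup>2"
proof -
  let ?m1 = "midpoint u1 v1" and ?m2 = "midpoint u2 v2"
  define e d z G K \<rho> where "e x = v1 x - v2 x" and "d x = u1 x - u2 x" and "z x = ?m1 x - ?m2 x"
    and "G x = laplacian ?m1 x - laplacian ?m2 x" and "K x = ?m1 x ^ 3 - ?m2 x ^ 3"
    and "\<rho> x = (Psi \<epsilon>AC \<tau> u1 v1 x - v1 x) - (Psi \<epsilon>AC \<tau> u2 v2 x - v2 x)" for x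
  have lap: "has_laplacian z G"
    unfolding z_def G_def by (intro has_laplacian_diff has_laplacian_laplacian dom)
  have int: "integrable torus (\<lambda>x. (d x)\<^sup>2)" "integrable torus (\<lambda>x. (e x)\<^sup>2)"
    "integrable torus (\<lambda>x. (\<rho> x)\<^sup>2)" "integrable torus (\<lambda>x. G x * z x)"
    unfolding d_def e_def \<rho>_def
    using lap by (auto intro!: L2_square_integrable L2_diff L2 res L2_mult_integrable simp: has_laplacian_def)
  have "(LINT x|torus. (e x)\<^sup>2)
      \<le> (LINT x|torus. 3 * (d x)\<^sup>2 + 4 * (\<rho> x)\<^sup>2 + 4 * (\<tau> * \<epsilon>AC\<^sup>2 * (G x * z x)))"
  proof (rule integral_mono)
    show "integrable torus (\<lambda>x. 3 * (d x)\<^sup>2 + 4 * (\<rho> x)\<^sup>2 + 4 * (\<tau> * \<epsilon>AC\<^sup>2 * (G x * z x)))"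
      using int by simp
    show "(e x)\<^sup>2 \<le> 3 * (d x)\<^sup>2 + 4 * (\<rho> x)\<^sup>2 + 4 * (\<tau> * \<epsilon>AC\<^sup>2 * (G x * z x))" for x
    proof (rule energy_inequality[OF \<tau>])
      show "z x = (d x + e x) / 2" by (simp add: z_def d_def e_def midpoint_def field_simps)
      show "K x * z x \<ge> 0" by (simp only: K_def z_def cube_diff_mult_nonneg)
      show "\<rho> x = d x - e x + \<tau> * (\<epsilon>AC\<^sup>2 * G x - K x + z x)"
        by (simp add: \<rho>_def d_def e_def G_def K_def z_def Psi_def AC_rhs_def algebra_simps)
    qed
  qed (use int in simp)
  also have "\<dots> = 3 * (LINT x|torus. (d x)\<^sup>2) + 4 * (LINT x|torus. (\<rho> x)\<^sup>2)
      + 4 * (\<tau> * \<epsilon>AC\<^sup>2 * (LINT x|torus. G x * z x))"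
    using int by simp
  also have "\<dots> \<le> 3 * (LINT x|torus. (d x)\<^sup>2) + 4 * (LINT x|torus. (\<rho> x)\<^sup>2)"
    using mult_nonneg_nonpos[OF _ laplacian_dissipative[OF lap], of "\<tau> * \<epsilon>AC\<^sup>2"] \<tau> by simp
  finally show ?thesis
    by (simp add: L2_norm_square e_def d_def \<rho>_def)
qed

text \<open>The residual of an exact step is composed of measurable functions and vanishes almost everywhere, hence
  it lies in \<open>L2\<close> whatever the integrability of its cubic term.\<close>

lemma midpoint_solution_residual:
  assumes "u \<in> L2" "midpoint_solution \<epsilon>AC \<alpha> \<tau> u v"
  shows "v \<in> L2" "midpoint u v \<in> laplacian_dom"
    and "(\<lambda>x. Psi \<epsilon>AC \<tau> u v x - v x) \<in> L2"
    and "AE x in torus. Psi \<epsilon>AC \<tau> u v x - v x = 0"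
proof -
  show v: "v \<in> L2" and m: "midpoint u v \<in> laplacian_dom"
    using assms(2) by (auto simp: midpoint_solution_def Hs_def)
  show ae: "AE x in torus. Psi \<epsilon>AC \<tau> u v x - v x = 0"
    using assms(2) by (auto simp: midpoint_solution_def)
  have [measurable]: "u \<in> borel_measurable torus" "v \<in> borel_measurable torus"
    "midpoint u v \<in> borel_measurable torus" "laplacian (midpoint u v) \<in> borel_measurable torus"
    using assms(1) v midpoint_L2[OF assms(1) v] has_laplacian_laplacian[OF m]
    by (auto simp: has_laplacian_def intro: L2_measurable)
  have [measurable]: "(\<lambda>x. Psi \<epsilon>AC \<tau> u v x - v x) \<in> borel_measurable torus"
    unfolding Psi_def AC_rhs_def by measurable
  have "integrable torus (\<lambda>x. (Psi \<epsilon>AC \<tau> u v x - v x)\<^sup>2) \<longleftrightarrow> integrable torus (\<lambda>x::real^'a. 0::real)"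
    by (intro integrable_cong_AE) (use ae in auto)
  then show "(\<lambda>x. Psi \<epsilon>AC \<tau> u v x - v x) \<in> L2"
    by (simp add: L2_def)
qed

text \<open>The exact step \<open>w\<close> has residual zero almost everywhere, so in the stability estimate only the residual
  of the candidate \<open>v\<close> for the step from \<open>p\<close> survives.\<close>

lemma midpoint_step_error:
  fixes u p w v :: "real ^ 'd \<Rightarrow> real"
  assumes \<tau>: "0 < \<tau>" "\<tau> \<le> 1 / 4"
    and L2: "u \<in> L2" "p \<in> L2" "v \<in> L2"
    and w: "midpoint_solution \<epsilon>AC \<alpha> \<tau> u w"
    and dom: "midpoint p v \<in> laplacian_dom" and res: "(\<lambda>x. Psi \<epsilon>AC \<tau> p v x - v x) \<in> L2"
  shows "(L2_norm (\<lambda>x. w x - v x))\<^sup>2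
    \<le> 3 * (L2_norm (\<lambda>x. u x - p x))\<^sup>2 + 4 * (L2_norm (\<lambda>x. Psi \<epsilon>AC \<tau> p v x - v x))\<^sup>2"
proof -
  note w' = midpoint_solution_residual[OF L2(1) w]
  let ?r = "\<lambda>x. Psi \<epsilon>AC \<tau> p v x - v x" and ?s = "\<lambda>x. Psi \<epsilon>AC \<tau> u w x - w x"
  have "(LINT x|torus. (?s x - ?r x)\<^sup>2) = (LINT x|torus. (?r x)\<^sup>2)"
  proof (rule integral_cong_AE)
    show "AE x in torus. (?s x - ?r x)\<^sup>2 = (?r x)\<^sup>2"
      using w'(4) by eventually_elim (simp add: power2_commute)
  qed (intro borel_measurable_power borel_measurable_diff[OF L2_measurable[OF w'(3)]]
      L2_measurable[OF res])+
  then have "(L2_norm (\<lambda>x. ?s x - ?r x))\<^sup>2 = (L2_norm ?r)\<^sup>2"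
    by (simp only: L2_norm_square)
  with midpoint_scheme_stability[OF \<tau> L2(1,2) w'(1) L2(3) w'(2) dom w'(3) res] show ?thesis
    by simp
qed

section \<open>Covering the Sobolev ball in the square norm\<close>

lemma bracket_ge_1: "bracket k \<ge> 1"
proof (cases "k = 0")
  case False
  then obtain i where "k $ i \<noteq> 0" by (auto simp: vec_eq_iff)
  then have "1 \<le> \<bar>freq k $ i\<bar>" by (simp add: freq_def)
  also have "\<dots> \<le> norm (freq k)" by (rule component_le_norm_cart)
  finally show ?thesis using False by (simp add: bracket_def)
qed (simp add: bracket_def)

lemma bracket_ge_component: "\<bar>real_of_int (k $ i)\<bar> \<le> bracket k"
proof (cases "k = 0")
  case False
  then show ?thesis
    using component_le_norm_cart[of "freq k" i] by (simp add: bracket_def freq_def)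
qed (simp add: bracket_def)

lemma ball_Hs_coeff_sum:
  assumes "u \<in> ball_Hs \<alpha> 1"
  obtains S where "((\<lambda>k. bracket k powr (2 * \<alpha>) * (cmod (fourier_coeff u k))\<^sup>2) has_sum S) UNIV" "S \<le> 1"
proof
  let ?f = "\<lambda>k. bracket k powr (2 * \<alpha>) * (cmod (fourier_coeff u k))\<^sup>2"
  show "(?f has_sum (\<Sum>\<^sub>\<infinity>k. ?f k)) UNIV"
    using assms by (intro has_sum_infsum) (simp add: ball_Hs_def Hs_def)
  have "sqrt (\<Sum>\<^sub>\<infinity>k. ?f k) \<le> 1" using assms by (simp add: ball_Hs_def Hs_norm_def)
  then show "(\<Sum>\<^sub>\<infinity>k. ?f k) \<le> 1" by simp
qed

lemma ball_Hs_coeff_le_1: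
  assumes "u \<in> ball_Hs \<alpha> 1" "\<alpha> \<ge> 0"
  shows "cmod (fourier_coeff u k) \<le> 1"
proof -
  obtain S where S: "((\<lambda>k. bracket k powr (2 * \<alpha>) * (cmod (fourier_coeff u k))\<^sup>2) has_sum S) UNIV" "S \<le> 1"
    using ball_Hs_coeff_sum[OF assms(1)] by blast
  have "bracket k powr (2 * \<alpha>) * (cmod (fourier_coeff u k))\<^sup>2 \<le> S"
    using has_sum_mono2[OF has_sum_finite[of "{k}"] S(1)] by simp
  moreover have "bracket k powr (2 * \<alpha>) \<ge> 1"
    using bracket_ge_1[of k] assms(2) by (intro ge_one_powr_ge_zero) auto
  then have "1 * (cmod (fourier_coeff u k))\<^sup>2 \<le> bracket k powr (2 * \<alpha>) * (cmod (fourier_coeff u k))\<^sup>2"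
    by (intro mult_right_mono) auto
  ultimately have "(cmod (fourier_coeff u k))\<^sup>2 \<le> 1" using S(2) by linarith
  then show ?thesis by (simp add: abs_square_le_1)
qed

lemma ball_Hs_L2: "u \<in> ball_Hs \<alpha> r \<Longrightarrow> u \<in> L2"
  by (simp add: ball_Hs_def Hs_def)

text \<open>Parseval's identity splits the distance. On the finite set \<open>A\<close> of low frequencies the coefficients are close
  by assumption; outside, the weight \<open>bracket k powr (2 * \<alpha>)\<close> is at least \<open>R powr (2 * \<alpha>)\<close>, and the weighted
  sums of both functions are at most 1.\<close>

lemma ball_Hs_L2_distance:
  fixes u v :: "real ^ 'd \<Rightarrow> real"
  assumes "u \<in> ball_Hs \<alpha> 1" "v \<in> ball_Hs \<alpha> 1" "\<alpha> \<ge> 0" "finite A" "R > 0"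
    and near: "\<And>k. k \<in> A \<Longrightarrow> (cmod (fourier_coeff u k - fourier_coeff v k))\<^sup>2 \<le> b"
    and far: "\<And>k. k \<notin> A \<Longrightarrow> R \<le> bracket k"
  shows "(LINT x|torus. (u x - v x)\<^sup>2)
    \<le> torus_volume TYPE('d) * (real (card A) * b + 4 * R powr (- 2 * \<alpha>))"
proof -
  let ?w = "\<lambda>u k. bracket k powr (2 * \<alpha>) * (cmod (fourier_coeff u k))\<^sup>2"
  let ?V = "torus_volume TYPE('d)"
  obtain S where S: "(?w u has_sum S) UNIV" "S \<le> 1" using ball_Hs_coeff_sum[OF assms(1)] by blast
  obtain S' where S': "(?w v has_sum S') UNIV" "S' \<le> 1" using ball_Hs_coeff_sum[OF assms(2)] by blast
  have "((\<lambda>k. if k \<in> A then b else 0) has_sum (\<Sum>k\<in>A. b)) UNIV"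
    by (rule has_sum_finite_neutralI[OF assms(4)]) auto
  then have rhs: "((\<lambda>k. (if k \<in> A then b else 0) + R powr (- 2 * \<alpha>) * (2 * ?w u k + 2 * ?w v k)) has_sum
      (\<Sum>k\<in>A. b) + R powr (- 2 * \<alpha>) * (2 * S + 2 * S')) UNIV"
    by (intro has_sum_add has_sum_cmult_right S S')
  have "(LINT x|torus. (u x - v x)\<^sup>2) / ?V \<le> (\<Sum>k\<in>A. b) + R powr (- 2 * \<alpha>) * (2 * S + 2 * S')"
  proof (rule has_sum_mono[OF parseval rhs])
    show "(\<lambda>x. u x - v x) \<in> L2" by (intro L2_diff ball_Hs_L2[OF assms(1)] ball_Hs_L2[OF assms(2)])
    fix k
    have diff: "fourier_coeff (\<lambda>x. u x - v x) k = fourier_coeff u k - fourier_coeff v k"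
      by (intro fourier_coeff_diff ball_Hs_L2[OF assms(1)] ball_Hs_L2[OF assms(2)])
    show "(cmod (fourier_coeff (\<lambda>x. u x - v x) k))\<^sup>2
        \<le> (if k \<in> A then b else 0) + R powr (- 2 * \<alpha>) * (2 * ?w u k + 2 * ?w v k)"
    proof (cases "k \<in> A")
      case True
      have "R powr (- 2 * \<alpha>) * (2 * ?w u k + 2 * ?w v k) \<ge> 0" by simp
      with near[OF True] show ?thesis
        unfolding diff if_P[OF True] by linarith
    next
      case False
      let ?a = "cmod (fourier_coeff u k)" and ?c = "cmod (fourier_coeff v k)"
      have "1 = R powr (- 2 * \<alpha>) * R powr (2 * \<alpha>)"
        using \<open>R > 0\<close> by (simp add: powr_add[symmetric])
      also have "\<dots> \<le> R powr (- 2 * \<alpha>) * bracket k powr (2 * \<alpha>)"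
        using far[OF False] assms(3,5) by (intro mult_left_mono powr_mono2) auto
      finally have one: "1 \<le> R powr (- 2 * \<alpha>) * bracket k powr (2 * \<alpha>)" .
      have "cmod (fourier_coeff u k - fourier_coeff v k) \<le> ?a + ?c" by (rule norm_triangle_ineq4)
      then have "(cmod (fourier_coeff u k - fourier_coeff v k))\<^sup>2 \<le> (?a + ?c)\<^sup>2"
        by (intro power_mono) auto
      also have "\<dots> \<le> 1 * (2 * ?a\<^sup>2 + 2 * ?c\<^sup>2)"
        using sum_squares_bound[of ?a ?c] by (simp add: power2_sum)
      also have "\<dots> \<le> R powr (- 2 * \<alpha>) * bracket k powr (2 * \<alpha>) * (2 * ?a\<^sup>2 + 2 * ?c\<^sup>2)"
        by (intro mult_right_mono one) auto
      also have "\<dots> = R powr (- 2 * \<alpha>) * (2 * ?w u k + 2 * ?w v k)" by (simp add: algebra_simps)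
      finally show ?thesis using False by (simp add: diff)
    qed
  qed
  also have "\<dots> \<le> real (card A) * b + R powr (- 2 * \<alpha>) * 4"
    using S(2) S'(2) by (intro add_mono mult_left_mono) auto
  finally show ?thesis by (simp add: field_simps)
qed

lemma finite_card_frequency_cube:
  fixes m :: nat
  defines "A \<equiv> {k :: int ^ 'd. \<forall>i. k $ i \<in> {- int m..int m}}"
  shows "finite A" "card A \<le> (2 * m + 1) ^ CARD('d)"
proof -
  let ?F = "PiE (UNIV :: 'd set) (\<lambda>_. {- int m..int m})"
  have inj: "inj_on vec_nth A" by (simp add: inj_on_def vec_nth_inject)
  have sub: "vec_nth ` A \<subseteq> ?F" by (auto simp: A_def)
  have fin: "finite ?F" by (intro finite_PiE) auto
  show "finite A" by (rule inj_on_finite[OF inj sub fin])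
  have "card A \<le> card ?F" by (rule card_inj_on_le[OF inj sub fin])
  also have "\<dots> = (nat (2 * int m + 1)) ^ CARD('d)" by (simp add: card_PiE)
  also have "nat (2 * int m + 1) = 2 * m + 1" by simp
  finally show "card A \<le> (2 * m + 1) ^ CARD('d)" .
qed

lemma floor_eq_imp_square_diff:
  assumes "\<lfloor>real n * a\<rfloor> = \<lfloor>real n * b\<rfloor>" "n > 0"
  shows "(a - b)\<^sup>2 \<le> 1 / (real n)\<^sup>2"
proof -
  have "\<bar>real n * a - real n * b\<bar> \<le> 1" using assms(1) by linarith
  then have "(real n * a - real n * b)\<^sup>2 \<le> 1" by (simp add: abs_square_le_1)
  then have "(real n)\<^sup>2 * (a - b)\<^sup>2 \<le> 1"
    by (simp add: power_mult_distrib[symmetric] right_diff_distrib)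
  then show ?thesis using assms(2) by (simp add: field_simps)
qed

text \<open>The pigeonhole argument: functions in the same cell have low coefficients that differ by at most \<open>1 / n\<close> in
  real and in imaginary part. Each of the at most \<open>(2 * m + 1) ^ CARD('d)\<close> low frequencies has
  \<open>(2 * n + 1)\<^sup>2\<close> cells. Taking representatives from \<open>B\<close> itself allows further constraints such as
  a supremum bound.\<close>

lemma ball_Hs_cover:
  fixes B :: "(real ^ 'd \<Rightarrow> real) set" and m n :: nat
  assumes B: "B \<subseteq> ball_Hs \<alpha> 1" and "\<alpha> \<ge> 0" "n > 0"
  shows "\<exists>P\<subseteq>B. finite P \<and> card P \<le> (2 * n + 1) ^ (2 * (2 * m + 1) ^ CARD('d)) \<and>
    (\<forall>u\<in>B. \<exists>p\<in>P. (LINT x|torus. (u x - p x)\<^sup>2) \<le> torus_volume TYPE('d) *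
      (2 * real ((2 * m + 1) ^ CARD('d)) / (real n)\<^sup>2 + 4 * (real m + 1) powr (- 2 * \<alpha>)))"
proof -
  define A where "A = {k :: int ^ 'd. \<forall>i. k $ i \<in> {- int m..int m}}"
  have A: "finite A" "card A \<le> (2 * m + 1) ^ CARD('d)"
    unfolding A_def by (rule finite_card_frequency_cube)+
  define cell where "cell u = (\<lambda>k\<in>A. (\<lfloor>real n * Re (fourier_coeff u k)\<rfloor>, \<lfloor>real n * Im (fourier_coeff u k)\<rfloor>))"
    for u :: "real ^ 'd \<Rightarrow> real"
  let ?I = "{- int n..int n}"
  let ?F = "PiE A (\<lambda>_. ?I \<times> ?I)"
  have floor_in: "\<lfloor>real n * t\<rfloor> \<in> ?I" if "\<bar>t\<bar> \<le> 1" for t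
  proof -
    have "\<bar>real n * t\<bar> \<le> real n * 1" unfolding abs_mult using that by (intro mult_mono) auto
    then show ?thesis by (auto simp: abs_le_iff le_floor_iff floor_le_iff)
  qed
  have sub: "cell ` B \<subseteq> ?F"
  proof (rule image_subsetI)
    fix u assume "u \<in> B"
    then have "cmod (fourier_coeff u k) \<le> 1" for k
      using B ball_Hs_coeff_le_1[OF _ \<open>\<alpha> \<ge> 0\<close>] by blast
    then have "\<bar>Re (fourier_coeff u k)\<bar> \<le> 1" "\<bar>Im (fourier_coeff u k)\<bar> \<le> 1" for k
      using abs_Re_le_cmod abs_Im_le_cmod order_trans by blast+
    then show "cell u \<in> ?F"
      by (intro PiE_I) (simp_all add: cell_def floor_in del: atLeastAtMost_iff)
  qed
  have fin: "finite ?F" using A(1) by (intro finite_PiE) auto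
  define P where "P = inv_into B cell ` (cell ` B)"
  show ?thesis
  proof (intro exI[of _ P] conjI ballI)
    show "P \<subseteq> B" unfolding P_def by (auto intro: inv_into_into)
    show "finite P" unfolding P_def using finite_subset[OF sub fin] by blast
    have "card P \<le> card (cell ` B)" unfolding P_def using finite_subset[OF sub fin] by (rule card_image_le)
    also have "\<dots> \<le> card ?F" by (rule card_mono[OF fin sub])
    also have "\<dots> = ((nat (2 * int n + 1))\<^sup>2) ^ card A"
      using A(1) by (simp add: card_PiE card_cartesian_product power2_eq_square)
    also have "nat (2 * int n + 1) = 2 * n + 1" by simp
    also have "((2 * n + 1)\<^sup>2) ^ card A \<le> ((2 * n + 1)\<^sup>2) ^ ((2 * m + 1) ^ CARD('d))"
      using A(2) by (intro power_increasing) auto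
    finally show "card P \<le> (2 * n + 1) ^ (2 * (2 * m + 1) ^ CARD('d))" by (simp only: power_mult)
    fix u assume "u \<in> B"
    define p where "p = inv_into B cell (cell u)"
    have p: "p \<in> B" "cell p = cell u" "p \<in> P"
      using \<open>u \<in> B\<close> by (auto simp: p_def P_def inv_into_into f_inv_into_f)
    have "(LINT x|torus. (u x - p x)\<^sup>2) \<le> torus_volume TYPE('d) *
      (real (card A) * (2 / (real n)\<^sup>2) + 4 * (real m + 1) powr (- 2 * \<alpha>))"
    proof (rule ball_Hs_L2_distance)
      show "u \<in> ball_Hs \<alpha> 1" "p \<in> ball_Hs \<alpha> 1" using B \<open>u \<in> B\<close> p(1) by auto
      fix k :: "int ^ 'd"
      show "(cmod (fourier_coeff u k - fourier_coeff p k))\<^sup>2 \<le> 2 / (real n)\<^sup>2" if "k \<in> A"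
      proof -
        have "cell p k = cell u k" using p(2) by simp
        then have "\<lfloor>real n * Re (fourier_coeff u k)\<rfloor> = \<lfloor>real n * Re (fourier_coeff p k)\<rfloor>"
          "\<lfloor>real n * Im (fourier_coeff u k)\<rfloor> = \<lfloor>real n * Im (fourier_coeff p k)\<rfloor>"
          using that by (simp_all add: cell_def)
        from this[THEN floor_eq_imp_square_diff, OF \<open>n > 0\<close>] show ?thesis
          unfolding cmod_power2 by simp
      qed
      show "real m + 1 \<le> bracket k" if "k \<notin> A"
      proof -
        obtain i where "k $ i \<notin> {- int m..int m}" using \<open>k \<notin> A\<close> unfolding A_def by blast
        then have "int m + 1 \<le> \<bar>k $ i\<bar>" by auto
        then have "real m + 1 \<le> \<bar>real_of_int (k $ i)\<bar>" by linarith
        with bracket_ge_component[of k i] show ?thesis by linarith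
      qed
    qed (use A(1) \<open>\<alpha> \<ge> 0\<close> in auto)
    also have "\<dots> \<le> torus_volume TYPE('d) *
      (real ((2 * m + 1) ^ CARD('d)) * (2 / (real n)\<^sup>2) + 4 * (real m + 1) powr (- 2 * \<alpha>))"
      by (intro mult_left_mono add_right_mono mult_right_mono of_nat_mono A(2)) auto
    finally show "\<exists>p\<in>P. (LINT x|torus. (u x - p x)\<^sup>2) \<le> torus_volume TYPE('d) *
      (2 * real ((2 * m + 1) ^ CARD('d)) / (real n)\<^sup>2 + 4 * (real m + 1) powr (- 2 * \<alpha>))"
      using p(3) by (intro bexI[of _ p]) (simp_all add: mult.commute)
  qed
qed

text \<open>The choice of the cutoff \<open>m = \<lceil>X\<rceil>\<close> with \<open>X = \<epsilon> powr (- 1 / \<alpha>)\<close> and of the mesh \<open>1 / n\<close>, \<open>n = \<lceil>D / \<epsilon>\<rceil>\<close>, where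
  \<open>D = (2 * m + 1) ^ d\<close>. The number of cells is a power with exponent \<open>2 * D\<close> and base below \<open>(4 / \<epsilon>) ^ 5\<close>, so it suffices
  that \<open>10 * D\<close> is at most \<open>2 ^ d * (2 * M + 1) ^ d\<close> with \<open>M = (\<epsilon> / 2) powr (1 / (2 - \<alpha>))\<close>. This follows from
  \<open>13 * X \<le> M\<close>, and it holds for small \<open>\<epsilon>\<close> because \<open>M / X\<close> grows like the power \<open>- \<gamma>\<close> of \<open>\<epsilon>\<close>.\<close>

lemma cover_parameters:
  fixes \<alpha> :: real and d :: nat
  assumes "\<alpha> > 2" "d \<in> {1, 2, 3}"
  obtains \<epsilon>1 where "\<epsilon>1 > 0"
    "\<And>\<epsilon>. 0 < \<epsilon> \<Longrightarrow> \<epsilon> < \<epsilon>1 \<Longrightarrow> \<exists>m n :: nat. n > 0 \<and>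
      2 * real ((2 * m + 1) ^ d) / (real n)\<^sup>2 + 4 * (real m + 1) powr (- 2 * \<alpha>) \<le> 6 * \<epsilon>\<^sup>2 \<and>
      real ((2 * n + 1) ^ (2 * (2 * m + 1) ^ d))
        \<le> (4 / \<epsilon>) powr (2 ^ d * (2 * (\<epsilon> / 2) powr (1 / (2 - \<alpha>)) + 1) ^ d)"
proof -
  define \<gamma> where "\<gamma> = 1 / (\<alpha> - 2) - 1 / \<alpha>"
  have "\<gamma> > 0" using assms(1) by (simp add: \<gamma>_def field_simps)
  define \<epsilon>1 where "\<epsilon>1 = min 1 (13 powr (- 1 / \<gamma>))"
  show thesis
  proof
    show "\<epsilon>1 > 0" by (simp add: \<epsilon>1_def)
    fix \<epsilon> :: real assume \<epsilon>: "0 < \<epsilon>" "\<epsilon> < \<epsilon>1"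
    then have "\<epsilon> \<le> 1" "\<epsilon> \<le> 13 powr (- 1 / \<gamma>)" by (auto simp: \<epsilon>1_def)
    define X where "X = \<epsilon> powr (- 1 / \<alpha>)"
    define M where "M = (\<epsilon> / 2) powr (1 / (2 - \<alpha>))"
    define Y where "Y = \<epsilon> powr (- 1 / 2)"
    define m where "m = nat \<lceil>X\<rceil>"
    define D where "D = (2 * m + 1) ^ d"
    define n where "n = nat \<lceil>real D / \<epsilon>\<rceil>"
    have "X \<ge> 1"
      unfolding X_def using powr_mono2'[of "- 1 / \<alpha>" \<epsilon> 1] \<epsilon>(1) \<open>\<epsilon> \<le> 1\<close> assms(1) by simp
    have "X \<le> Y"
      unfolding X_def Y_def using \<epsilon>(1) \<open>\<epsilon> \<le> 1\<close> assms(1)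
      by (intro powr_mono') (auto simp: field_simps)
    have "Y \<ge> 1" using \<open>X \<ge> 1\<close> \<open>X \<le> Y\<close> by simp
    have m: "X \<le> real m" "real m \<le> X + 1" using \<open>X \<ge> 1\<close> unfolding m_def by linarith+
    have "D \<ge> 1" by (simp add: D_def)
    then have "real D / \<epsilon> \<ge> 1" using \<epsilon>(1) \<open>\<epsilon> \<le> 1\<close> by (simp add: field_simps)
    then have n: "real D / \<epsilon> \<le> real n" "real n \<le> real D / \<epsilon> + 1" "n > 0"
      unfolding n_def by linarith+
    \<comment> \<open>Both parts of the squared covering radius are of order \<open>\<epsilon>\<^sup>2\<close>.\<close>
    have "2 * real D / (real n)\<^sup>2 \<le> 2 * \<epsilon>\<^sup>2"
    proof -
      have "(real D)\<^sup>2 \<le> (\<epsilon> * real n)\<^sup>2"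
        using n(1) \<epsilon>(1) by (intro power_mono) (auto simp: field_simps)
      moreover have "real D * 1 \<le> real D * real D" using \<open>D \<ge> 1\<close> by (intro mult_left_mono) auto
      ultimately have "real D \<le> \<epsilon>\<^sup>2 * (real n)\<^sup>2" by (simp add: power2_eq_square mult_ac)
      then show ?thesis using n(3) by (simp add: field_simps)
    qed
    moreover have "(real m + 1) powr (- 2 * \<alpha>) \<le> \<epsilon>\<^sup>2"
    proof -
      have "(real m + 1) powr (- 2 * \<alpha>) \<le> X powr (- 2 * \<alpha>)"
        using m \<open>X \<ge> 1\<close> assms(1) by (intro powr_mono2') auto
      also have "\<dots> = \<epsilon> powr 2" using assms(1) by (simp add: X_def powr_powr)
      also have "\<dots> = \<epsilon>\<^sup>2" using \<epsilon>(1) by simp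
      finally show ?thesis .
    qed
    ultimately have radius: "2 * real D / (real n)\<^sup>2 + 4 * (real m + 1) powr (- 2 * \<alpha>) \<le> 6 * \<epsilon>\<^sup>2"
      by linarith
    \<comment> \<open>The bounds \<open>\<alpha> > 2\<close> and \<open>d \<le> 3\<close> give \<open>D \<le> 125 * \<epsilon> powr (- 3 / 2)\<close>, and \<open>625 \<le> 4 ^ 5\<close>.\<close>
    have "real (2 * n + 1) \<le> (4 / \<epsilon>) ^ 5"
    proof -
      have "real (2 * n + 1) \<le> 5 * (real D / \<epsilon>)" using n \<open>real D / \<epsilon> \<ge> 1\<close> by simp
      moreover have "real D \<le> (5 * Y) ^ d"
        unfolding D_def of_nat_power using m \<open>X \<le> Y\<close> \<open>Y \<ge> 1\<close> by (intro power_mono) auto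
      moreover have "(5 * Y) ^ d \<le> (5 * Y) ^ 3"
        using assms(2) \<open>Y \<ge> 1\<close> by (intro power_increasing) auto
      moreover have "Y ^ 3 \<le> (1 / \<epsilon>) ^ 2"
      proof -
        have "Y ^ 3 = \<epsilon> powr (- 3 / 2)" using \<epsilon>(1) by (simp add: Y_def powr_power)
        also have "\<dots> \<le> \<epsilon> powr (- 2)" using \<epsilon>(1) \<open>\<epsilon> \<le> 1\<close> by (intro powr_mono') auto
        also have "\<dots> = (1 / \<epsilon>) ^ 2"
          using \<epsilon>(1) by (simp add: powr_minus power_one_over inverse_eq_divide)
        finally show ?thesis .
      qed
      ultimately have "real D \<le> 125 * (1 / \<epsilon>) ^ 2" by (simp add: power_mult_distrib)
      then have "5 * (real D / \<epsilon>) \<le> 5 * (125 * (1 / \<epsilon>) ^ 2 / \<epsilon>)"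
        using \<epsilon>(1) by (intro mult_left_mono divide_right_mono) auto
      also have "\<dots> = 625 * (1 / \<epsilon>) ^ 3" by (simp add: power2_eq_square power3_eq_cube)
      also have "\<dots> \<le> 1024 * (1 / \<epsilon>) ^ 5"
        using \<epsilon>(1) \<open>\<epsilon> \<le> 1\<close> by (intro mult_mono power_increasing) auto
      also have "\<dots> = (4 / \<epsilon>) ^ 5" by (simp add: power_divide)
      finally show ?thesis using \<open>real (2 * n + 1) \<le> 5 * (real D / \<epsilon>)\<close> by linarith
    qed
    then have "real (2 * n + 1) ^ (2 * D) \<le> ((4 / \<epsilon>) ^ 5) ^ (2 * D)"
      by (intro power_mono) auto
    also have "\<dots> = (4 / \<epsilon>) powr (real (10 * D))"
      using \<epsilon>(1) by (subst powr_realpow) (auto simp flip: power_mult)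
    also have "\<dots> \<le> (4 / \<epsilon>) powr (2 ^ d * (2 * M + 1) ^ d)"
    proof (rule powr_mono)
      have "13 \<le> \<epsilon> powr (- \<gamma>)"
      proof -
        have "13 = (13 powr (- 1 / \<gamma>)) powr (- \<gamma>)" using \<open>\<gamma> > 0\<close> by (simp add: powr_powr)
        also have "\<dots> \<le> \<epsilon> powr (- \<gamma>)"
          using \<epsilon>(1) \<open>\<epsilon> \<le> 13 powr (- 1 / \<gamma>)\<close> \<open>\<gamma> > 0\<close> by (intro powr_mono2') auto
        finally show ?thesis .
      qed
      then have "13 * X \<le> \<epsilon> powr (- \<gamma>) * X" using \<open>X \<ge> 1\<close> by (intro mult_right_mono) auto
      also have "\<dots> = \<epsilon> powr (1 / (2 - \<alpha>))"
      proof -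
        have "1 / (2 - \<alpha>) = - (1 / (\<alpha> - 2))" by (simp add: divide_simps)
        then show ?thesis by (simp add: X_def \<gamma>_def powr_add[symmetric])
      qed
      also have "\<dots> \<le> M"
        unfolding M_def using \<epsilon>(1) assms(1) by (intro powr_mono2') auto
      finally have "13 * X \<le> M" .
      then have "real (10 * (2 * m + 1)) \<le> 2 * (2 * M + 1)" using m \<open>X \<ge> 1\<close> by simp
      then have "real (10 * (2 * m + 1)) ^ d \<le> (2 * (2 * M + 1)) ^ d" by (intro power_mono) auto
      moreover have "(10 :: real) \<le> 10 ^ d" using assms(2) by auto
      then have "10 * real D \<le> 10 ^ d * real D" by (intro mult_right_mono) auto
      moreover have "real (10 * (2 * m + 1)) ^ d = 10 ^ d * real D"
        by (simp only: of_nat_mult power_mult_distrib D_def of_nat_power of_nat_numeral)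
      ultimately show "real (10 * D) \<le> 2 ^ d * (2 * M + 1) ^ d"
        unfolding power_mult_distrib[symmetric] by simp
    qed (use \<epsilon>(1) \<open>\<epsilon> \<le> 1\<close> in \<open>auto simp: field_simps\<close>)
    finally show "\<exists>m n :: nat. n > 0 \<and>
      2 * real ((2 * m + 1) ^ d) / (real n)\<^sup>2 + 4 * (real m + 1) powr (- 2 * \<alpha>) \<le> 6 * \<epsilon>\<^sup>2 \<and>
      real ((2 * n + 1) ^ (2 * (2 * m + 1) ^ d))
        \<le> (4 / \<epsilon>) powr (2 ^ d * (2 * (\<epsilon> / 2) powr (1 / (2 - \<alpha>)) + 1) ^ d)"
      using n(3) radius unfolding D_def M_def
      by (intro exI[of _ m] exI[of _ n]) (simp only: of_nat_power simp_thms)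
  qed
qed

section \<open>The generalisation error\<close>

lemma zero_in_ball: "(\<lambda>x. 0) \<in> ball_Hs \<alpha> 1 \<inter> ball_Linf 1"
proof -
  have "esssup torus (\<lambda>x::real^'a. ereal \<bar>0\<bar>) \<le> ereal 1"
    by (rule esssup_I) auto
  then show ?thesis
    by (simp add: ball_Hs_def Hs_def Hs_norm_def ball_Linf_def)
qed

lemma L2_norm_le:
  assumes "(LINT x|torus. (u x)\<^sup>2) \<le> c\<^sup>2" "c \<ge> 0"
  shows "L2_norm u \<le> c"
  using assms unfolding L2_norm_def by (simp add: real_le_lsqrt)

text \<open>Below the threshold \<open>\<epsilon>1\<close> the pigeonhole cover works with radius \<open>sqrt (6 * V) * \<epsilon>\<close>, \<open>V\<close> being the volume of the
  torus. Above it the zero function alone is a cover, since every function of the ball has norm at most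
  \<open>sqrt (4 * V)\<close>; both radii go into \<open>C\<close>.\<close>

lemma training_set:
  fixes \<alpha> :: real
  assumes "\<alpha> > 2" "CARD('d::finite) \<in> {1, 2, 3}"
  obtains C where "C > 0"
    "\<And>\<epsilon>. \<epsilon> > 0 \<Longrightarrow> \<exists>P :: (real ^ 'd \<Rightarrow> real) set.
      P \<subseteq> ball_Hs \<alpha> 1 \<inter> ball_Linf 1 \<and> finite P \<and> P \<noteq> {} \<and>
      real (card P) \<le> of_int \<lceil>(4 / \<epsilon>) powr
        (2 ^ CARD('d) * (2 * (\<epsilon> / 2) powr (1 / (2 - \<alpha>)) + 1) ^ CARD('d))\<rceil> \<and>
      (\<forall>u\<in>ball_Hs \<alpha> 1 \<inter> ball_Linf 1. \<exists>p\<in>P. L2_norm (\<lambda>x. u x - p x) \<le> C * \<epsilon>)"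
proof -
  let ?B = "ball_Hs \<alpha> 1 \<inter> ball_Linf 1 :: (real ^ 'd \<Rightarrow> real) set"
  let ?V = "torus_volume TYPE('d)"
  let ?E = "\<lambda>\<epsilon>. (4 / \<epsilon>) powr (2 ^ CARD('d) * (2 * (\<epsilon> / 2) powr (1 / (2 - \<alpha>)) + 1) ^ CARD('d))"
  have "\<alpha> \<ge> 0" using assms by simp
  obtain \<epsilon>1 where "\<epsilon>1 > 0" and param: "\<And>\<epsilon>. 0 < \<epsilon> \<Longrightarrow> \<epsilon> < \<epsilon>1 \<Longrightarrow> \<exists>m n :: nat. n > 0 \<and>
      2 * real ((2 * m + 1) ^ CARD('d)) / (real n)\<^sup>2 + 4 * (real m + 1) powr (- 2 * \<alpha>) \<le> 6 * \<epsilon>\<^sup>2 \<and>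
      real ((2 * n + 1) ^ (2 * (2 * m + 1) ^ CARD('d))) \<le> ?E \<epsilon>"
    using cover_parameters[OF assms] by blast
  define C where "C = sqrt (6 * ?V) + sqrt (4 * ?V) / \<epsilon>1"
  show thesis
  proof
    show "C > 0" using \<open>\<epsilon>1 > 0\<close> by (simp add: C_def add_pos_pos)
    fix \<epsilon> :: real assume "\<epsilon> > 0"
    show "\<exists>P. P \<subseteq> ?B \<and> finite P \<and> P \<noteq> {} \<and> real (card P) \<le> of_int \<lceil>?E \<epsilon>\<rceil> \<and>
      (\<forall>u\<in>?B. \<exists>p\<in>P. L2_norm (\<lambda>x. u x - p x) \<le> C * \<epsilon>)"
    proof (cases "\<epsilon> < \<epsilon>1")
      case True
      then obtain m n :: nat where n: "n > 0"
        and rad: "2 * real ((2 * m + 1) ^ CARD('d)) / (real n)\<^sup>2 + 4 * (real m + 1) powr (- 2 * \<alpha>) \<le> 6 * \<epsilon>\<^sup>2"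
        and cnt: "real ((2 * n + 1) ^ (2 * (2 * m + 1) ^ CARD('d))) \<le> ?E \<epsilon>"
        using param[OF \<open>\<epsilon> > 0\<close>] by blast
      obtain P where P: "P \<subseteq> ?B" "finite P" "card P \<le> (2 * n + 1) ^ (2 * (2 * m + 1) ^ CARD('d))"
        and near: "\<And>u. u \<in> ?B \<Longrightarrow> \<exists>p\<in>P. (LINT x|torus. (u x - p x)\<^sup>2) \<le> ?V *
          (2 * real ((2 * m + 1) ^ CARD('d)) / (real n)\<^sup>2 + 4 * (real m + 1) powr (- 2 * \<alpha>))"
        using ball_Hs_cover[OF Int_lower1 \<open>\<alpha> \<ge> 0\<close> n, of "ball_Linf 1 :: (real ^ 'd \<Rightarrow> real) set" m] by blast
      have "P \<noteq> {}" using near[OF zero_in_ball] by blast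
      moreover have "real (card P) \<le> of_int \<lceil>?E \<epsilon>\<rceil>"
      proof -
        have "real (card P) \<le> real ((2 * n + 1) ^ (2 * (2 * m + 1) ^ CARD('d)))"
          using P(3) by (simp only: of_nat_le_iff)
        from order_trans[OF order_trans[OF this cnt] le_of_int_ceiling] show ?thesis .
      qed
      moreover have "\<exists>p\<in>P. L2_norm (\<lambda>x. u x - p x) \<le> C * \<epsilon>" if "u \<in> ?B" for u
      proof -
        obtain p where "p \<in> P" and p: "(LINT x|torus. (u x - p x)\<^sup>2) \<le> ?V *
          (2 * real ((2 * m + 1) ^ CARD('d)) / (real n)\<^sup>2 + 4 * (real m + 1) powr (- 2 * \<alpha>))"
          using near[OF \<open>u \<in> ?B\<close>] by blast
        note p
        also have "\<dots> \<le> ?V * (6 * \<epsilon>\<^sup>2)" by (intro mult_left_mono rad) simp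
        also have "\<dots> = (sqrt (6 * ?V) * \<epsilon>)\<^sup>2" by (simp add: power_mult_distrib)
        finally have "L2_norm (\<lambda>x. u x - p x) \<le> sqrt (6 * ?V) * \<epsilon>"
          by (rule L2_norm_le) (use \<open>\<epsilon> > 0\<close> in simp)
        also have "\<dots> \<le> C * \<epsilon>"
          using \<open>\<epsilon> > 0\<close> \<open>\<epsilon>1 > 0\<close> by (intro mult_right_mono) (auto simp: C_def)
        finally show ?thesis using \<open>p \<in> P\<close> by blast
      qed
      ultimately show ?thesis using P(1,2) by blast
    next
      case False
      have "L2_norm (\<lambda>x. u x - 0) \<le> C * \<epsilon>" if "u \<in> ?B" for u
      proof -
        have "(LINT x|torus. (u x - 0)\<^sup>2) \<le> (sqrt (4 * ?V))\<^sup>2"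
        proof -
          have "(\<lambda>x::real ^ 'd. 0) \<in> ball_Hs \<alpha> 1" using zero_in_ball by blast
          moreover have "u \<in> ball_Hs \<alpha> 1" using \<open>u \<in> ?B\<close> by blast
          ultimately have "(LINT x|torus. (u x - 0)\<^sup>2)
              \<le> ?V * (real (card ({} :: (int ^ 'd) set)) * 0 + 4 * 1 powr (- 2 * \<alpha>))"
            using \<open>\<alpha> \<ge> 0\<close> by (intro ball_Hs_L2_distance) (auto simp: bracket_ge_1)
          then show ?thesis by (simp add: mult_ac)
        qed
        then have "L2_norm (\<lambda>x. u x - 0) \<le> sqrt (4 * ?V)"
          by (rule L2_norm_le) simp
        also have "\<dots> \<le> sqrt (4 * ?V) / \<epsilon>1 * \<epsilon>"
          using False \<open>\<epsilon>1 > 0\<close> by (simp add: field_simps mult_right_mono)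
        also have "\<dots> \<le> C * \<epsilon>" using \<open>\<epsilon> > 0\<close> by (intro mult_right_mono) (auto simp: C_def)
        finally show ?thesis .
      qed
      moreover have "?E \<epsilon> > 0" using \<open>\<epsilon> > 0\<close> by simp
      then have "\<lceil>?E \<epsilon>\<rceil> \<ge> 1" by linarith
      then have "1 \<le> real_of_int \<lceil>?E \<epsilon>\<rceil>" by linarith
      ultimately show ?thesis
        using zero_in_ball by (intro exI[of _ "{\<lambda>x. 0}"]) simp
    qed
  qed
qed

text \<open>If the residual at \<open>p\<close> is infinite there is nothing to show. Otherwise the triangle inequality through
  \<open>F p\<close>, in the form \<open>(a - b)\<^sup>2 \<le> 2 * a\<^sup>2 + 2 * b\<^sup>2\<close>, combines \<open>midpoint_step_error\<close> with the Lipschitz bound; the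
  constants 3 and \<open>3 + 2 * \<bar>L\<bar>\<close> are convenient upper bounds for the resulting square roots.\<close>

lemma generalisation_from_nearby_sample:
  fixes u p :: "real ^ 'd \<Rightarrow> real" and F :: "(real ^ 'd \<Rightarrow> real) \<Rightarrow> real ^ 'd \<Rightarrow> real"
  assumes \<tau>: "0 < \<tau>" "\<tau> \<le> 1 / 4"
    and well: "midpoint_wellposed TYPE('d) \<epsilon>AC \<alpha> \<tau>" and lip: "L2_Lipschitz L F"
    and u: "u \<in> Hs \<alpha>" and p: "p \<in> L2" and near: "L2_norm (\<lambda>x. u x - p x) \<le> \<eta>"
  shows "L2_enorm (\<lambda>x. Phi \<epsilon>AC \<alpha> \<tau> u x - F u x)
    \<le> ennreal 3 * residual_enorm \<epsilon>AC \<tau> p (F p) + ennreal ((3 + 2 * \<bar>L\<bar>) * \<eta>)"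
proof (cases "midpoint p (F p) \<in> laplacian_dom \<and> (\<lambda>x. Psi \<epsilon>AC \<tau> p (F p) x - F p x) \<in> L2")
  case False
  then have "residual_enorm \<epsilon>AC \<tau> p (F p) = \<infinity>"
    by (auto simp: residual_enorm_def L2_enorm_def)
  then show ?thesis by (simp add: ennreal_mult_top)
next
  case True
  have uL2: "u \<in> L2" using u by (simp add: Hs_def)
  have F: "F u \<in> L2" "F p \<in> L2"
    and Flip: "L2_norm (\<lambda>x. F u x - F p x) \<le> L * L2_norm (\<lambda>x. u x - p x)"
    using lip uL2 p by (auto simp: L2_Lipschitz_def)
  let ?w = "Phi \<epsilon>AC \<alpha> \<tau> u"
  define d r s q where "d = L2_norm (\<lambda>x. u x - p x)" and "r = L2_norm (\<lambda>x. Psi \<epsilon>AC \<tau> p (F p) x - F p x)"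
    and "s = L2_norm (\<lambda>x. F u x - F p x)" and "q = L2_norm (\<lambda>x. ?w x - F p x)"
  have nn: "d \<ge> 0" "r \<ge> 0" "s \<ge> 0" "q \<ge> 0"
    by (simp_all add: d_def r_def s_def q_def L2_norm_nonneg)
  have w: "midpoint_solution \<epsilon>AC \<alpha> \<tau> u ?w"
    unfolding Phi_def using well u by (intro someI_ex[where P="midpoint_solution \<epsilon>AC \<alpha> \<tau> u"])
      (auto simp: midpoint_wellposed_def)
  note wL2 = midpoint_solution_residual(1)[OF uL2 w]
  have q: "q\<^sup>2 \<le> 3 * d\<^sup>2 + 4 * r\<^sup>2"
    unfolding q_def d_def r_def using midpoint_step_error[OF \<tau> uL2 p F(2) w] True by blast
  have "s \<le> \<bar>L\<bar> * d"
    using Flip mult_right_mono[OF abs_ge_self nn(1), of L] by (simp add: s_def d_def)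
  then have s: "s\<^sup>2 \<le> (\<bar>L\<bar> * d)\<^sup>2" using nn by (intro power_mono)
  have int: "integrable torus (\<lambda>x. (?w x - F p x)\<^sup>2)" "integrable torus (\<lambda>x. (F u x - F p x)\<^sup>2)"
    "integrable torus (\<lambda>x. (?w x - F u x)\<^sup>2)"
    by (intro L2_square_integrable L2_diff wL2 F)+
  have "(LINT x|torus. (?w x - F u x)\<^sup>2)
      \<le> (LINT x|torus. 2 * (?w x - F p x)\<^sup>2 + 2 * (F u x - F p x)\<^sup>2)"
  proof (rule integral_mono)
    show "(?w x - F u x)\<^sup>2 \<le> 2 * (?w x - F p x)\<^sup>2 + 2 * (F u x - F p x)\<^sup>2" for x
      using zero_le_power2[of "(?w x - F p x) + (F u x - F p x)"]
      by (simp add: power2_eq_square algebra_simps)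
  qed (use int in simp_all)
  also have "\<dots> = 2 * q\<^sup>2 + 2 * s\<^sup>2"
    using int by (simp add: q_def s_def L2_norm_square)
  also have "\<dots> \<le> 6 * d\<^sup>2 + 8 * r\<^sup>2 + 2 * (\<bar>L\<bar> * d)\<^sup>2" using q s by linarith
  also have "\<dots> \<le> (3 * r + (3 + 2 * \<bar>L\<bar>) * d)\<^sup>2"
  proof -
    have "(3 * r + (3 + 2 * \<bar>L\<bar>) * d)\<^sup>2 = 6 * d\<^sup>2 + 8 * r\<^sup>2 + 2 * (\<bar>L\<bar> * d)\<^sup>2 +
       (r\<^sup>2 + 3 * d\<^sup>2 + 2 * (\<bar>L\<bar> * d)\<^sup>2 + 6 * (r * ((3 + 2 * \<bar>L\<bar>) * d)) + 12 * (\<bar>L\<bar> * d * d))"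
      by (simp add: power2_eq_square algebra_simps)
    moreover have "0 \<le> r\<^sup>2 + 3 * d\<^sup>2 + 2 * (\<bar>L\<bar> * d)\<^sup>2 + 6 * (r * ((3 + 2 * \<bar>L\<bar>) * d)) + 12 * (\<bar>L\<bar> * d * d)"
      using nn by (intro add_nonneg_nonneg mult_nonneg_nonneg) auto
    ultimately show ?thesis by linarith
  qed
  finally have "L2_norm (\<lambda>x. ?w x - F u x) \<le> 3 * r + (3 + 2 * \<bar>L\<bar>) * d"
    by (rule L2_norm_le) (use nn in simp)
  also have "\<dots> \<le> 3 * r + (3 + 2 * \<bar>L\<bar>) * \<eta>"
    using near by (intro add_left_mono mult_left_mono) (auto simp: d_def)
  finally have "ennreal (L2_norm (\<lambda>x. ?w x - F u x)) \<le> ennreal (3 * r + (3 + 2 * \<bar>L\<bar>) * \<eta>)"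
    by (rule ennreal_leI)
  also have "\<dots> = ennreal 3 * ennreal r + ennreal ((3 + 2 * \<bar>L\<bar>) * \<eta>)"
  proof -
    have "\<eta> \<ge> 0" using near nn(1) by (simp add: d_def)
    then show ?thesis
      using nn by (subst ennreal_plus) (auto simp: ennreal_mult)
  qed
  also have "ennreal r = residual_enorm \<epsilon>AC \<tau> p (F p)"
    using True by (simp add: residual_enorm_def L2_enorm_def r_def)
  finally show ?thesis
    using L2_diff[OF wL2 F(1)] by (simp add: L2_enorm_def)
qed

theorem theorem3p4:
  fixes Phi_star :: "real \<Rightarrow> (real ^ 'd \<Rightarrow> real) \<Rightarrow> real ^ 'd \<Rightarrow> real"
    and \<alpha> \<epsilon>AC L \<tau>max :: real
  assumes "CARD('d) \<in> {1, 2, 3}"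
    and "\<alpha> > 2"
    and "\<epsilon>AC > 0"
    and "\<tau>max > 0"
    and "\<And>\<tau>. 0 < \<tau> \<Longrightarrow> \<tau> < \<tau>max \<Longrightarrow> midpoint_wellposed TYPE('d) \<epsilon>AC \<alpha> \<tau>"
    and "\<And>\<tau>. 0 < \<tau> \<Longrightarrow> \<tau> < \<tau>max \<Longrightarrow> L2_Lipschitz L (Phi_star \<tau>)"
  shows "\<exists>C1 C2 \<tau>0 K :: real. C1 > 0 \<and> C2 > 0 \<and> 0 < \<tau>0 \<and> \<tau>0 \<le> \<tau>max \<and> K > 0 \<and>
    (\<forall>\<epsilon>>0. \<exists>N\<epsilon> :: nat.
      (\<forall>N>N\<epsilon>. \<exists>u :: nat \<Rightarrow> real ^ 'd \<Rightarrow> real.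
        (\<forall>j\<in>{1..N}. u j \<in> ball_Hs \<alpha> 1 \<inter> ball_Linf 1) \<and>
        (\<forall>\<tau>. 0 < \<tau> \<longrightarrow> \<tau> < \<tau>0 \<longrightarrow>
          generalisation_error \<epsilon>AC \<alpha> \<tau> (Phi_star \<tau>)
            \<le> ennreal C1 * training_error \<epsilon>AC \<tau> (Phi_star \<tau>) N u + ennreal (C2 * \<epsilon>))) \<and>
      real N\<epsilon> \<le> K * of_int \<lceil>(4 / \<epsilon>) powr
        (2 ^ CARD('d) * (2 * (\<epsilon> / 2) powr (1 / (2 - \<alpha>)) + 1) ^ CARD('d))\<rceil>)"
proof -
  let ?B = "ball_Hs \<alpha> 1 \<inter> ball_Linf 1 :: (real ^ 'd \<Rightarrow> real) set"
  let ?E = "\<lambda>\<epsilon>. (4 / \<epsilon>) powr (2 ^ CARD('d) * (2 * (\<epsilon> / 2) powr (1 / (2 - \<alpha>)) + 1) ^ CARD('d))"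
  obtain C where "C > 0" and cover: "\<And>\<epsilon>. \<epsilon> > 0 \<Longrightarrow> \<exists>P :: (real ^ 'd \<Rightarrow> real) set.
      P \<subseteq> ?B \<and> finite P \<and> P \<noteq> {} \<and> real (card P) \<le> of_int \<lceil>?E \<epsilon>\<rceil> \<and>
      (\<forall>u\<in>?B. \<exists>p\<in>P. L2_norm (\<lambda>x. u x - p x) \<le> C * \<epsilon>)"
    using training_set[OF assms(2,1)] by blast
  define C2 where "C2 = (3 + 2 * \<bar>L\<bar>) * C"
  define \<tau>0 where "\<tau>0 = min \<tau>max (1 / 4)"
  have main: "\<exists>N\<epsilon> :: nat.
      (\<forall>N>N\<epsilon>. \<exists>u :: nat \<Rightarrow> real ^ 'd \<Rightarrow> real.
        (\<forall>j\<in>{1..N}. u j \<in> ?B) \<and>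
        (\<forall>\<tau>. 0 < \<tau> \<longrightarrow> \<tau> < \<tau>0 \<longrightarrow>
          generalisation_error \<epsilon>AC \<alpha> \<tau> (Phi_star \<tau>)
            \<le> ennreal 3 * training_error \<epsilon>AC \<tau> (Phi_star \<tau>) N u + ennreal (C2 * \<epsilon>))) \<and>
      real N\<epsilon> \<le> 1 * of_int \<lceil>?E \<epsilon>\<rceil>" if "\<epsilon> > 0" for \<epsilon>
  proof -
    obtain P where P: "P \<subseteq> ?B" "finite P" "P \<noteq> {}" "real (card P) \<le> of_int \<lceil>?E \<epsilon>\<rceil>"
      and near: "\<And>u. u \<in> ?B \<Longrightarrow> \<exists>p\<in>P. L2_norm (\<lambda>x. u x - p x) \<le> C * \<epsilon>"
      using cover[OF \<open>\<epsilon> > 0\<close>] by blast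
    obtain h where h: "bij_betw h {1..card P} P"
      using ex_bij_betw_nat_finite_1[OF P(2)] by blast
    obtain p0 where "p0 \<in> P" using P(3) by blast
    \<comment> \<open>A sample with more than \<open>card P\<close> data runs through \<open>P\<close> and then repeats one of its members.\<close>
    define u where "u j = (if j \<in> {1..card P} then h j else p0)" for j
    have u_P: "u j \<in> P" for j
      using bij_betwE[OF h] \<open>p0 \<in> P\<close> by (simp add: u_def)
    have bound: "generalisation_error \<epsilon>AC \<alpha> \<tau> (Phi_star \<tau>)
        \<le> ennreal 3 * training_error \<epsilon>AC \<tau> (Phi_star \<tau>) N u + ennreal (C2 * \<epsilon>)"
      if "N > card P" "0 < \<tau>" "\<tau> < \<tau>0" for N \<tau>
      unfolding generalisation_error_def
    proof (rule SUP_least)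
      let ?r = "\<lambda>j. residual_enorm \<epsilon>AC \<tau> (u j) (Phi_star \<tau> (u j))"
      fix v assume v: "v \<in> ?B"
      obtain p where p: "p \<in> P" "L2_norm (\<lambda>x. v x - p x) \<le> C * \<epsilon>" using near[OF v] by blast
      have "p \<in> h ` {1..card P}" using h p(1) by (simp add: bij_betw_def)
      then obtain j where j: "j \<in> {1..card P}" "h j = p" by blast
      then have "u j = p" by (simp add: u_def)
      have "p \<in> L2" using p(1) P(1) ball_Hs_L2 by blast
      moreover have "v \<in> Hs \<alpha>" using v by (simp add: ball_Hs_def)
      ultimately have "L2_enorm (\<lambda>x. Phi \<epsilon>AC \<alpha> \<tau> v x - Phi_star \<tau> v x)
          \<le> ennreal 3 * residual_enorm \<epsilon>AC \<tau> p (Phi_star \<tau> p) + ennreal ((3 + 2 * \<bar>L\<bar>) * (C * \<epsilon>))"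
        using that(2,3) p(2)
        by (intro generalisation_from_nearby_sample assms(5,6)) (auto simp: \<tau>0_def)
      also have "residual_enorm \<epsilon>AC \<tau> p (Phi_star \<tau> p) \<le> training_error \<epsilon>AC \<tau> (Phi_star \<tau>) N u"
        unfolding training_error_def \<open>u j = p\<close>[symmetric]
        using j(1) that(1) by (intro Max_ge) auto
      finally show "L2_enorm (\<lambda>x. Phi \<epsilon>AC \<alpha> \<tau> v x - Phi_star \<tau> v x)
          \<le> ennreal 3 * training_error \<epsilon>AC \<tau> (Phi_star \<tau>) N u + ennreal (C2 * \<epsilon>)"
        by (simp add: C2_def mult.assoc mult_left_mono add_right_mono)
    qed
    show ?thesis
      using P(1,4) u_P bound by (intro exI[of _ "card P"] conjI allI impI exI[of _ u]) auto
  qed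
  show ?thesis
    by (intro exI[of _ 3] exI[of _ C2] exI[of _ \<tau>0] exI[of _ 1] conjI allI impI main)
      (use \<open>C > 0\<close> assms(4) in \<open>auto simp: C2_def \<tau>0_def\<close>)
qed

end
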